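(* Let $H$ be a finite-dimensional Hopf algebra over a field $\Bbbk$ and let $(\zeta,\gamma^* )$ be a partially admissible mapping system for $\iota:B\rightarrowtail H$ with quotient $\pi:H\twoheadrightarrow C$. Then the following are equivalent: (1) $(\zeta,\gamma^* )$ is admissible; (2) $\gamma(C)$ is a right coideal subalgebra of $H$; (3) $\zeta^*(B^* )$ is a left coideal subalgebra of $H^*$.
   Context: All spaces are over $\Bbbk$; $\otimes=\otimes_\Bbbk$; $(-)^*$ denotes linear dual/transpose; $\langle-,-\rangle$ evaluation; Sweedler notation is used. A left (resp. right) coideal subalgebra of a Hopf algebra $K$ is a subalgebra $A$ with $\Delta(A)\subseteq K\otimes A$ (resp. $\Delta(A)\subseteq A\otimes K$). Partially admissible mapping system. Let $H$ be a finite-dimensional Hopf algebra, $\iota:B\rightarrowtail H$ an injective map of left $H$-comodule algebras, $\pi:H\twoheadrightarrow C$ a surjective map of right $H$-module coalgebras (action $\blacktriangleleft$ on $C$), with $\iota(B)=\{h\in H:\sum h_{(1)}\otimes\pi(h_{(2)})=h\otimes\pi(1)\}$. A partially admissible mapping system $(\zeta,\gamma^* )$ for $\iota$ consists of linear maps $\zeta:H\to B$, $\gamma:C\to H$ (with transposes $\zeta^*:B^*\to H^*$, $\gamma^*:H^*\to C^*$) such that: $\zeta,\gamma$ are convolution invertible; $\zeta(\iota(b)h)=b\,\zeta(h)$ and $\sum\gamma(x)_{(1)}\otimes\pi(\gamma(x)_{(2)})=\sum\gamma(x_{(1)})\otimes x_{(2)}$; $\zeta(1)=1$, $\varepsilon\circ\iota\circ\zeta=\varepsilon$,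 $\gamma(\pi(1))=1$, $\varepsilon\circ\gamma=\varepsilon_C$; and $\sum\iota(\zeta(h_{(1)}))\gamma(\pi(h_{(2)}))=h$. Admissibility. Write $\sum f_{(1)}\otimes f_{(2)}\in C^*\otimes H^*$ for the coaction on $f\in C^*$ determined by $\langle f,x\blacktriangleleft h\rangle=\sum\langle f_{(1)},x\rangle\langle f_{(2)},h\rangle$ and $\sum b_{(1)}\otimes b_{(2)}\in H\otimes B$ for the coaction on $b\in B$. The left partial dual of $H$ determined by $(\zeta,\gamma^* )$ is a quasi-Hopf algebra whose underlying algebra is the smash product $C^*\#B=C^*\otimes B$, $(f\#b)(g\#c)=\sum fg_{(1)}\#\langle g_{(2)},b_{(1)}\rangle b_{(2)}c$, unit $\varepsilon\#1$, and whose associator $\boldsymbol\phi$ has inverse $$\boldsymbol\phi^{-1}=\sum_{i,j}\big(\varepsilon\#\zeta[\gamma(f_i^* )\gamma(f_j^* )_{(1)}]\big)\otimes\big(f_i\#\zeta[\gamma(f_j^* )_{(2)}]\big)\otimes(f_j\#1),$$ where $\{f_i\}$ is a basis of $C^*$ with dual basis $\{f_i^*\}$ of $C$. $(\zeta,\gamma^* )$ is called admissible if $\boldsymbol\phi$ is trivial, i.e. $\boldsymbol\phi=(\varepsilon\#1)^{\otimes3}$. *)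

theory Defs
  imports Complex_Main "HOL-Library.Function_Algebras"
begin

section \<open>Vector spaces, duals and tensor products\<close>

text \<open>
  The spaces $H$, $B$, $C$ of the theory are whole types with a scalar multiplication, as in
  \<^theory>\<open>HOL.Vector_Spaces\<close>. Dual spaces and tensor products are proper subspaces of function
  types; a record pairs such a subspace with its scalar multiplication. Function types carry
  the pointwise addition of \<^theory>\<open>HOL-Library.Function_Algebras\<close>.
\<close>

record ('k, 'a) vspace =
  carr :: "'a set"
  scl :: "'k \<Rightarrow> 'a \<Rightarrow> 'a"

definition whole :: "('k \<Rightarrow> 'a \<Rightarrow> 'a) \<Rightarrow> ('k, 'a) vspace" where
  "whole s = \<lparr>carr = UNIV, scl = s\<rparr>"

definition fscale :: "'k::field \<Rightarrow> ('x \<Rightarrow> 'k) \<Rightarrow> 'x \<Rightarrow> 'k" where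
  "fscale c f = (\<lambda>x. c * f x)"

definition dual :: "('k::field \<Rightarrow> 'a::ab_group_add \<Rightarrow> 'a) \<Rightarrow> ('k, 'a \<Rightarrow> 'k) vspace" where
  "dual s = \<lparr>carr = {f. Vector_Spaces.linear s (*) f}, scl = fscale\<rparr>"

definition linear_form :: "('k::field, 'a::ab_group_add) vspace \<Rightarrow> ('a \<Rightarrow> 'k) \<Rightarrow> bool" where
  "linear_form V f \<longleftrightarrow>
     (\<forall>x\<in>carr V. \<forall>y\<in>carr V. f (x + y) = f x + f y) \<and>
     (\<forall>c. \<forall>x\<in>carr V. f (scl V c x) = c * f x)"

definition bilinear_form ::
  "('k::field, 'a::ab_group_add) vspace \<Rightarrow> ('k, 'b::ab_group_add) vspace \<Rightarrow> ('a \<Rightarrow> 'b \<Rightarrow> 'k) \<Rightarrow> bool"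
  where
  "bilinear_form V W \<beta> \<longleftrightarrow>
     (\<forall>v\<in>carr V. linear_form W (\<lambda>w. \<beta> v w)) \<and>
     (\<forall>w\<in>carr W. linear_form V (\<lambda>v. \<beta> v w))"

definition trilinear_form ::
  "('k::field, 'a::ab_group_add) vspace \<Rightarrow> ('k, 'b::ab_group_add) vspace \<Rightarrow>
   ('k, 'c::ab_group_add) vspace \<Rightarrow> ('a \<Rightarrow> 'b \<Rightarrow> 'c \<Rightarrow> 'k) \<Rightarrow> bool" where
  "trilinear_form U V W \<tau> \<longleftrightarrow>
     (\<forall>u\<in>carr U. \<forall>v\<in>carr V. linear_form W (\<lambda>w. \<tau> u v w)) \<and>
     (\<forall>u\<in>carr U. \<forall>w\<in>carr W. linear_form V (\<lambda>v. \<tau> u v w)) \<and>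
     (\<forall>v\<in>carr V. \<forall>w\<in>carr W. linear_form U (\<lambda>u. \<tau> u v w))"

text \<open>
  As in Halmos' book on finite-dimensional vector spaces, $V \otimes W$ is constructed inside the
  dual of the space of bilinear forms on $V \times W$: the pure tensor $v \otimes w$ is evaluation
  of bilinear forms at $(v,w)$, and $V \otimes W$ is the span of the pure tensors. (Over a field
  the canonical map from $V \otimes W$ to this dual is injective, in any dimension.) Arguments
  that are not bilinear forms are sent to $0$, so that equality of tensors is equality of
  functions. Triple tensor products use trilinear forms in the same way.

  Hence for $t = \sum t_{(1)} \otimes t_{(2)}$ and a bilinear $\beta$, the scalar
  $\sum \beta(t_{(1)}, t_{(2)})$ is just the application of $t$ to $\beta$, and a term
  \<open>\<Delta> h (\<lambda>h1 h2. \<dots>)\<close> below is a sum in Sweedler notation. A tensor-valued sum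
  $\sum F(t_{(1)},t_{(2)})$ is computed pointwise as \<open>\<lambda>\<beta>. t (\<lambda>x y. F x y \<beta>)\<close>.
\<close>

type_synonym ('k, 'a, 'b) tensor2 = "('a \<Rightarrow> 'b \<Rightarrow> 'k) \<Rightarrow> 'k"
type_synonym ('k, 'a, 'b, 'c) tensor3 = "('a \<Rightarrow> 'b \<Rightarrow> 'c \<Rightarrow> 'k) \<Rightarrow> 'k"

definition tensor ::
  "('k::field, 'a::ab_group_add) vspace \<Rightarrow> ('k, 'b::ab_group_add) vspace \<Rightarrow>
   'a \<Rightarrow> 'b \<Rightarrow> ('k, 'a, 'b) tensor2" where
  "tensor V W v w = (\<lambda>\<beta>. if bilinear_form V W \<beta> then \<beta> v w else 0)"

definition ttensor ::
  "('k::field, 'a::ab_group_add) vspace \<Rightarrow> ('k, 'b::ab_group_add) vspace \<Rightarrow>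
   ('k, 'c::ab_group_add) vspace \<Rightarrow> 'a \<Rightarrow> 'b \<Rightarrow> 'c \<Rightarrow> ('k, 'a, 'b, 'c) tensor3" where
  "ttensor U V W u v w = (\<lambda>\<tau>. if trilinear_form U V W \<tau> then \<tau> u v w else 0)"

definition tensor_span ::
  "('k::field, 'a::ab_group_add) vspace \<Rightarrow> ('k, 'b::ab_group_add) vspace \<Rightarrow>
   'a set \<Rightarrow> 'b set \<Rightarrow> ('k, 'a, 'b) tensor2 set" where
  "tensor_span V W X Y = module.span fscale {tensor V W x y | x y. x \<in> X \<and> y \<in> Y}"

definition tensor_space ::
  "('k::field, 'a::ab_group_add) vspace \<Rightarrow> ('k, 'b::ab_group_add) vspace \<Rightarrow>
   ('k, ('k, 'a, 'b) tensor2) vspace" where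
  "tensor_space V W = \<lparr>carr = tensor_span V W (carr V) (carr W), scl = fscale\<rparr>"

definition ttensor_space ::
  "('k::field, 'a::ab_group_add) vspace \<Rightarrow> ('k, 'b::ab_group_add) vspace \<Rightarrow>
   ('k, 'c::ab_group_add) vspace \<Rightarrow> ('k, ('k, 'a, 'b, 'c) tensor3) vspace" where
  "ttensor_space U V W =
     \<lparr>carr = module.span fscale
               {ttensor U V W u v w | u v w. u \<in> carr U \<and> v \<in> carr V \<and> w \<in> carr W},
      scl = fscale\<rparr>"

text \<open>The map $f \otimes g$ with values in $V \otimes W$.\<close>

definition tensor_map ::
  "('k::field, 'c::ab_group_add) vspace \<Rightarrow> ('k, 'd::ab_group_add) vspace \<Rightarrow>
   ('a \<Rightarrow> 'c) \<Rightarrow> ('b \<Rightarrow> 'd) \<Rightarrow> ('k, 'a, 'b) tensor2 \<Rightarrow> ('k, 'c, 'd) tensor2" where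
  "tensor_map V W f g t = (\<lambda>\<beta>. t (\<lambda>x y. tensor V W (f x) (g y) \<beta>))"

text \<open>
  The vector $\sum F(t_{(1)},t_{(2)})$ for a bilinear map $F$ with values in a type with scalar
  multiplication \<open>s\<close>: the unique vector on which every linear form $\varphi$ takes the value
  $\sum \varphi(F(t_{(1)},t_{(2)}))$.
\<close>

definition sweedler ::
  "('k::field \<Rightarrow> 'u::ab_group_add \<Rightarrow> 'u) \<Rightarrow> ('k, 'a, 'b) tensor2 \<Rightarrow> ('a \<Rightarrow> 'b \<Rightarrow> 'u) \<Rightarrow> 'u" where
  "sweedler s t F = (THE u. \<forall>\<phi>\<in>carr (dual s). \<phi> u = t (\<lambda>x y. \<phi> (F x y)))"


section \<open>Hopf algebras, comodule algebras and module coalgebras\<close>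

locale algebra_over = vector_space s
  for s :: "'k::field \<Rightarrow> 'a::ring_1 \<Rightarrow> 'a" +
  assumes scale_mult_left: "s c x * y = s c (x * y)"
    and scale_mult_right: "x * s c y = s c (x * y)"

locale coalgebra_over = vector_space s
  for s :: "'k::field \<Rightarrow> 'a::ab_group_add \<Rightarrow> 'a" +
  fixes \<Delta> :: "'a \<Rightarrow> ('k, 'a, 'a) tensor2" and \<epsilon> :: "'a \<Rightarrow> 'k"
  assumes comult_closed: "\<Delta> x \<in> carr (tensor_space (whole s) (whole s))"
    and comult_linear: "Vector_Spaces.linear s fscale \<Delta>"
    and counit_linear: "Vector_Spaces.linear s (*) \<epsilon>"
    and coassoc:
      "(\<lambda>\<tau>. \<Delta> x (\<lambda>x1 x2. \<Delta> x1 (\<lambda>x11 x12. ttensor (whole s) (whole s) (whole s) x11 x12 x2 \<tau>))) =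
       (\<lambda>\<tau>. \<Delta> x (\<lambda>x1 x2. \<Delta> x2 (\<lambda>x21 x22. ttensor (whole s) (whole s) (whole s) x1 x21 x22 \<tau>)))"
    and counit_left: "sweedler s (\<Delta> x) (\<lambda>x1 x2. s (\<epsilon> x1) x2) = x"
    and counit_right: "sweedler s (\<Delta> x) (\<lambda>x1 x2. s (\<epsilon> x2) x1) = x"

locale hopf_algebra = algebra_over s + coalgebra_over s \<Delta> \<epsilon>
  for s :: "'k::field \<Rightarrow> 'h::ring_1 \<Rightarrow> 'h" and \<Delta> \<epsilon> +
  fixes S :: "'h \<Rightarrow> 'h"
  assumes comult_one: "\<Delta> 1 = tensor (whole s) (whole s) 1 1"
    and comult_mult:
      "\<Delta> (h * k) = (\<lambda>\<beta>. \<Delta> h (\<lambda>h1 h2. \<Delta> k (\<lambda>k1 k2. tensor (whole s) (whole s) (h1 * k1) (h2 * k2) \<beta>)))"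
    and counit_one: "\<epsilon> 1 = 1"
    and counit_mult: "\<epsilon> (h * k) = \<epsilon> h * \<epsilon> k"
    and antipode_linear: "Vector_Spaces.linear s s S"
    and antipode_left: "sweedler s (\<Delta> h) (\<lambda>h1 h2. S h1 * h2) = s (\<epsilon> h) 1"
    and antipode_right: "sweedler s (\<Delta> h) (\<lambda>h1 h2. h1 * S h2) = s (\<epsilon> h) 1"

locale finite_dimensional_hopf_algebra = hopf_algebra +
  assumes finite_dimensional: "\<exists>E. finite_dimensional_vector_space s E"

locale left_comodule_algebra =
  H: hopf_algebra sH \<Delta>H \<epsilon>H S + B: algebra_over sB
  for sH :: "'k::field \<Rightarrow> 'h::ring_1 \<Rightarrow> 'h" and \<Delta>H \<epsilon>H S
    and sB :: "'k \<Rightarrow> 'b::ring_1 \<Rightarrow> 'b" +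
  fixes \<rho> :: "'b \<Rightarrow> ('k, 'h, 'b) tensor2"
  assumes coaction_closed: "\<rho> b \<in> carr (tensor_space (whole sH) (whole sB))"
    and coaction_linear: "Vector_Spaces.linear sB fscale \<rho>"
    and coaction_coassoc:
      "(\<lambda>\<tau>. \<rho> b (\<lambda>b1 b2. \<Delta>H b1 (\<lambda>b11 b12. ttensor (whole sH) (whole sH) (whole sB) b11 b12 b2 \<tau>))) =
       (\<lambda>\<tau>. \<rho> b (\<lambda>b1 b2. \<rho> b2 (\<lambda>b21 b22. ttensor (whole sH) (whole sH) (whole sB) b1 b21 b22 \<tau>)))"
    and coaction_counit: "sweedler sB (\<rho> b) (\<lambda>b1 b2. sB (\<epsilon>H b1) b2) = b"
    and coaction_one: "\<rho> 1 = tensor (whole sH) (whole sB) 1 1"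
    and coaction_mult:
      "\<rho> (b * c) = (\<lambda>\<beta>. \<rho> b (\<lambda>b1 b2. \<rho> c (\<lambda>c1 c2. tensor (whole sH) (whole sB) (b1 * c1) (b2 * c2) \<beta>)))"

locale right_module_coalgebra =
  H: hopf_algebra sH \<Delta>H \<epsilon>H S + C: coalgebra_over sC \<Delta>C \<epsilon>C
  for sH :: "'k::field \<Rightarrow> 'h::ring_1 \<Rightarrow> 'h" and \<Delta>H \<epsilon>H S
    and sC :: "'k \<Rightarrow> 'c::ab_group_add \<Rightarrow> 'c" and \<Delta>C \<epsilon>C +
  fixes act :: "'c \<Rightarrow> 'h \<Rightarrow> 'c"
  assumes act_linear_left: "Vector_Spaces.linear sC sC (\<lambda>x. act x h)"
    and act_linear_right: "Vector_Spaces.linear sH sC (\<lambda>h. act x h)"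
    and act_one: "act x 1 = x"
    and act_mult: "act x (h * k) = act (act x h) k"
    and comult_act:
      "\<Delta>C (act x h) =
        (\<lambda>\<beta>. \<Delta>C x (\<lambda>x1 x2. \<Delta>H h (\<lambda>h1 h2. tensor (whole sC) (whole sC) (act x1 h1) (act x2 h2) \<beta>)))"
    and counit_act: "\<epsilon>C (act x h) = \<epsilon>C x * \<epsilon>H h"


section \<open>Partially admissible mapping systems\<close>

text \<open>Convolution on linear maps from a coalgebra to an algebra with scalar multiplication \<open>s\<close>.\<close>

definition convolution ::
  "('x \<Rightarrow> ('k::field, 'x, 'x) tensor2) \<Rightarrow> ('k \<Rightarrow> 'a::ring_1 \<Rightarrow> 'a) \<Rightarrow>
   ('x \<Rightarrow> 'a) \<Rightarrow> ('x \<Rightarrow> 'a) \<Rightarrow> 'x \<Rightarrow> 'a" where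
  "convolution \<Delta> s f g x = sweedler s (\<Delta> x) (\<lambda>x1 x2. f x1 * g x2)"

definition convolution_invertible ::
  "('k::field \<Rightarrow> 'x::ab_group_add \<Rightarrow> 'x) \<Rightarrow> ('x \<Rightarrow> ('k, 'x, 'x) tensor2) \<Rightarrow> ('x \<Rightarrow> 'k) \<Rightarrow>
   ('k \<Rightarrow> 'a::ring_1 \<Rightarrow> 'a) \<Rightarrow> ('x \<Rightarrow> 'a) \<Rightarrow> bool" where
  "convolution_invertible sX \<Delta> \<epsilon> s f \<longleftrightarrow>
     (\<exists>g. Vector_Spaces.linear sX s g \<and>
       (\<forall>x. convolution \<Delta> s f g x = s (\<epsilon> x) 1 \<and> convolution \<Delta> s g f x = s (\<epsilon> x) 1))"

text \<open>
  The assumptions \<open>iota_comodule_map\<close> and \<open>pi_module_map\<close> refer to the regular coaction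
  \<open>\<Delta>H\<close> and the regular right action of $H$ on itself. The map $\gamma^*$ of the pair
  $(\zeta,\gamma^*)$ is represented by $\gamma$, whose transpose it is.
\<close>

locale partially_admissible_mapping_system =
  finite_dimensional_hopf_algebra sH \<Delta>H \<epsilon>H S +
  left_comodule_algebra sH \<Delta>H \<epsilon>H S sB \<rho> +
  right_module_coalgebra sH \<Delta>H \<epsilon>H S sC \<Delta>C \<epsilon>C act
  for sH :: "'k::field \<Rightarrow> 'h::ring_1 \<Rightarrow> 'h" and \<Delta>H \<epsilon>H S
    and sB :: "'k \<Rightarrow> 'b::ring_1 \<Rightarrow> 'b" and \<rho>
    and sC :: "'k \<Rightarrow> 'c::ab_group_add \<Rightarrow> 'c" and \<Delta>C \<epsilon>C act +
  fixes \<iota> :: "'b \<Rightarrow> 'h" and \<pi> :: "'h \<Rightarrow> 'c" and \<zeta> :: "'h \<Rightarrow> 'b" and \<gamma> :: "'c \<Rightarrow> 'h"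
  assumes iota_linear: "Vector_Spaces.linear sB sH \<iota>"
    and iota_one: "\<iota> 1 = 1"
    and iota_mult: "\<iota> (b * c) = \<iota> b * \<iota> c"
    and iota_comodule_map: "\<Delta>H (\<iota> b) = tensor_map (whole sH) (whole sH) id \<iota> (\<rho> b)"
    and iota_inj: "inj \<iota>"
    and pi_linear: "Vector_Spaces.linear sH sC \<pi>"
    and pi_comult: "\<Delta>C (\<pi> h) = tensor_map (whole sC) (whole sC) \<pi> \<pi> (\<Delta>H h)"
    and pi_counit: "\<epsilon>C (\<pi> h) = \<epsilon>H h"
    and pi_module_map: "\<pi> (h * k) = act (\<pi> h) k"
    and pi_surj: "surj \<pi>"
    and coinvariants:
      "range \<iota> = {h. tensor_map (whole sH) (whole sC) id \<pi> (\<Delta>H h) = tensor (whole sH) (whole sC) h (\<pi> 1)}"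
    and zeta_linear: "Vector_Spaces.linear sH sB \<zeta>"
    and gamma_linear: "Vector_Spaces.linear sC sH \<gamma>"
    and zeta_invertible: "convolution_invertible sH \<Delta>H \<epsilon>H sB \<zeta>"
    and gamma_invertible: "convolution_invertible sC \<Delta>C \<epsilon>C sH \<gamma>"
    and zeta_module_map: "\<zeta> (\<iota> b * h) = b * \<zeta> h"
    and gamma_comodule_map:
      "tensor_map (whole sH) (whole sC) id \<pi> (\<Delta>H (\<gamma> x)) = tensor_map (whole sH) (whole sC) \<gamma> id (\<Delta>C x)"
    and zeta_one: "\<zeta> 1 = 1"
    and counit_zeta: "\<epsilon>H (\<iota> (\<zeta> h)) = \<epsilon>H h"
    and gamma_one: "\<gamma> (\<pi> 1) = 1"
    and counit_gamma: "\<epsilon>H (\<gamma> x) = \<epsilon>C x"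
    and zeta_gamma: "sweedler sH (\<Delta>H h) (\<lambda>h1 h2. \<iota> (\<zeta> h1) * \<gamma> (\<pi> h2)) = h"


section \<open>Dual Hopf algebra and coideal subalgebras\<close>

text \<open>Product of the algebra dual to a coalgebra: $\langle fg,x\rangle = \sum f(x_{(1)})g(x_{(2)})$.\<close>

definition dual_mult ::
  "('x \<Rightarrow> ('k::field, 'x, 'x) tensor2) \<Rightarrow> ('x \<Rightarrow> 'k) \<Rightarrow> ('x \<Rightarrow> 'k) \<Rightarrow> 'x \<Rightarrow> 'k" where
  "dual_mult \<Delta> f g = (\<lambda>x. \<Delta> x (\<lambda>x1 x2. f x1 * g x2))"

text \<open>
  For a bilinear map $m : X \times Y \to X$ with $X$, $Y$ finite-dimensional: the element
  $\sum f_{(1)} \otimes f_{(2)} \in X^* \otimes Y^*$ determined by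
  $\langle f, m(x,y)\rangle = \sum \langle f_{(1)},x\rangle\langle f_{(2)},y\rangle$.
\<close>

definition dual_coaction ::
  "('k::field \<Rightarrow> 'x::ab_group_add \<Rightarrow> 'x) \<Rightarrow> ('k \<Rightarrow> 'y::ab_group_add \<Rightarrow> 'y) \<Rightarrow>
   ('x \<Rightarrow> 'y \<Rightarrow> 'x) \<Rightarrow> ('x \<Rightarrow> 'k) \<Rightarrow> ('k, 'x \<Rightarrow> 'k, 'y \<Rightarrow> 'k) tensor2" where
  "dual_coaction sX sY m f =
     (THE t. t \<in> carr (tensor_space (dual sX) (dual sY)) \<and>
       (\<forall>x y. t (\<lambda>f1 f2. f1 x * f2 y) = f (m x y)))"

definition dual_comult ::
  "('k::field \<Rightarrow> 'h::ring_1 \<Rightarrow> 'h) \<Rightarrow> ('h \<Rightarrow> 'k) \<Rightarrow> ('k, 'h \<Rightarrow> 'k, 'h \<Rightarrow> 'k) tensor2" where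
  "dual_comult s = dual_coaction s s (*)"

text \<open>
  The Hopf algebra $K$ enters through its underlying space \<open>V\<close>, product, unit and
  comultiplication, since these notions are applied both to $H$ and to $H^*$.
\<close>

definition is_subalgebra ::
  "('k::field, 'a::ab_group_add) vspace \<Rightarrow> ('a \<Rightarrow> 'a \<Rightarrow> 'a) \<Rightarrow> 'a \<Rightarrow> 'a set \<Rightarrow> bool" where
  "is_subalgebra V mult one A \<longleftrightarrow>
     A \<subseteq> carr V \<and> module.subspace (scl V) A \<and> one \<in> A \<and> (\<forall>a\<in>A. \<forall>b\<in>A. mult a b \<in> A)"

definition left_coideal_subalgebra ::
  "('k::field, 'a::ab_group_add) vspace \<Rightarrow> ('a \<Rightarrow> 'a \<Rightarrow> 'a) \<Rightarrow> 'a \<Rightarrow>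
   ('a \<Rightarrow> ('k, 'a, 'a) tensor2) \<Rightarrow> 'a set \<Rightarrow> bool" where
  "left_coideal_subalgebra V mult one \<Delta> A \<longleftrightarrow>
     is_subalgebra V mult one A \<and> (\<forall>a\<in>A. \<Delta> a \<in> tensor_span V V (carr V) A)"

definition right_coideal_subalgebra ::
  "('k::field, 'a::ab_group_add) vspace \<Rightarrow> ('a \<Rightarrow> 'a \<Rightarrow> 'a) \<Rightarrow> 'a \<Rightarrow>
   ('a \<Rightarrow> ('k, 'a, 'a) tensor2) \<Rightarrow> 'a set \<Rightarrow> bool" where
  "right_coideal_subalgebra V mult one \<Delta> A \<longleftrightarrow>
     is_subalgebra V mult one A \<and> (\<forall>a\<in>A. \<Delta> a \<in> tensor_span V V A (carr V))"

definition transpose_map :: "('a \<Rightarrow> 'b) \<Rightarrow> ('b \<Rightarrow> 'k) \<Rightarrow> 'a \<Rightarrow> 'k" where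
  "transpose_map f \<phi> = \<phi> \<circ> f"


section \<open>The left partial dual and admissibility\<close>

definition smash_space ::
  "('k::field \<Rightarrow> 'b::ring_1 \<Rightarrow> 'b) \<Rightarrow> ('k \<Rightarrow> 'c::ab_group_add \<Rightarrow> 'c) \<Rightarrow>
   ('k, ('k, 'c \<Rightarrow> 'k, 'b) tensor2) vspace" where
  "smash_space sB sC = tensor_space (dual sC) (whole sB)"

definition smash ::
  "('k::field \<Rightarrow> 'b::ring_1 \<Rightarrow> 'b) \<Rightarrow> ('k \<Rightarrow> 'c::ab_group_add \<Rightarrow> 'c) \<Rightarrow>
   ('c \<Rightarrow> 'k) \<Rightarrow> 'b \<Rightarrow> ('k, 'c \<Rightarrow> 'k, 'b) tensor2" where
  "smash sB sC = tensor (dual sC) (whole sB)"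

text \<open>$(f \# b)(g \# c) = \sum f g_{(1)} \# \langle g_{(2)}, b_{(1)}\rangle b_{(2)} c$.\<close>

definition smash_mult ::
  "('k::field \<Rightarrow> 'h::ring_1 \<Rightarrow> 'h) \<Rightarrow> ('k \<Rightarrow> 'b::ring_1 \<Rightarrow> 'b) \<Rightarrow> ('b \<Rightarrow> ('k, 'h, 'b) tensor2) \<Rightarrow>
   ('k \<Rightarrow> 'c::ab_group_add \<Rightarrow> 'c) \<Rightarrow> ('c \<Rightarrow> ('k, 'c, 'c) tensor2) \<Rightarrow> ('c \<Rightarrow> 'h \<Rightarrow> 'c) \<Rightarrow>
   ('k, 'c \<Rightarrow> 'k, 'b) tensor2 \<Rightarrow> ('k, 'c \<Rightarrow> 'k, 'b) tensor2 \<Rightarrow> ('k, 'c \<Rightarrow> 'k, 'b) tensor2" where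
  "smash_mult sH sB \<rho> sC \<Delta>C act u v =
     (\<lambda>\<beta>. u (\<lambda>f b. v (\<lambda>g c.
        dual_coaction sC sH act g (\<lambda>g1 g2. \<rho> b (\<lambda>b1 b2.
          smash sB sC (dual_mult \<Delta>C f g1) (sB (g2 b1) (b2 * c)) \<beta>)))))"

text \<open>The componentwise product on $D \otimes D \otimes D$ for an algebra $D$ with product \<open>m\<close>.\<close>

definition ttensor_mult ::
  "('k::field, 'd::ab_group_add) vspace \<Rightarrow> ('d \<Rightarrow> 'd \<Rightarrow> 'd) \<Rightarrow>
   ('k, 'd, 'd, 'd) tensor3 \<Rightarrow> ('k, 'd, 'd, 'd) tensor3 \<Rightarrow> ('k, 'd, 'd, 'd) tensor3" where
  "ttensor_mult D m p q =
     (\<lambda>\<tau>. p (\<lambda>a b c. q (\<lambda>a' b' c'. ttensor D D D (m a a') (m b b') (m c c') \<tau>)))"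

text \<open>
  The sum over $i,j$ runs over a basis \<open>E\<close> of $C$ (the vectors $f_i^*$); the dual basis
  $f_i$ of $C^*$ consists of the coordinate functions.
  The result does not depend on the chosen basis.
\<close>

definition inverse_associator ::
  "('h \<Rightarrow> ('k::field, 'h, 'h) tensor2) \<Rightarrow> ('k \<Rightarrow> 'b::ring_1 \<Rightarrow> 'b) \<Rightarrow>
   ('k \<Rightarrow> 'c::ab_group_add \<Rightarrow> 'c) \<Rightarrow> ('c \<Rightarrow> 'k) \<Rightarrow> ('h::ring_1 \<Rightarrow> 'b) \<Rightarrow> ('c \<Rightarrow> 'h) \<Rightarrow>
   ('k, ('k, 'c \<Rightarrow> 'k, 'b) tensor2, ('k, 'c \<Rightarrow> 'k, 'b) tensor2, ('k, 'c \<Rightarrow> 'k, 'b) tensor2) tensor3"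
  where
  "inverse_associator \<Delta>H sB sC \<epsilon>C \<zeta> \<gamma> =
     (let E = (SOME E. finite_dimensional_vector_space sC E);
          f = (\<lambda>e x. module.representation sC E x e);
          D = smash_space sB sC
      in (\<lambda>\<tau>. \<Sum>i\<in>E. \<Sum>j\<in>E. \<Delta>H (\<gamma> j) (\<lambda>y1 y2.
           ttensor D D D
             (smash sB sC \<epsilon>C (\<zeta> (\<gamma> i * y1)))
             (smash sB sC (f i) (\<zeta> y2))
             (smash sB sC (f j) 1) \<tau>)))"

text \<open>
  The associator $\phi$ is the inverse of \<open>inverse_associator\<close> in
  $(C^* \# B)^{\otimes 3}$. Inverses being unique, the system is admissible iff the unit
  element $(\varepsilon \# 1)^{\otimes 3}$ is this associator.
\<close>

definition is_associator where
  "is_associator sH \<Delta>H sB \<rho> sC \<Delta>C \<epsilon>C act \<zeta> \<gamma> \<phi> \<longleftrightarrow>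
     (let D = smash_space sB sC;
          m = ttensor_mult D (smash_mult sH sB \<rho> sC \<Delta>C act);
          one = smash sB sC \<epsilon>C 1;
          \<psi> = inverse_associator \<Delta>H sB sC \<epsilon>C \<zeta> \<gamma>
      in \<phi> \<in> carr (ttensor_space D D D) \<and>
         m \<phi> \<psi> = ttensor D D D one one one \<and> m \<psi> \<phi> = ttensor D D D one one one)"

definition admissible where
  "admissible sH \<Delta>H sB \<rho> sC \<Delta>C \<epsilon>C act \<zeta> \<gamma> \<longleftrightarrow>
     (let D = smash_space sB sC; one = smash sB sC \<epsilon>C 1
      in is_associator sH \<Delta>H sB \<rho> sC \<Delta>C \<epsilon>C act \<zeta> \<gamma> (ttensor D D D one one one))"

end

theory Submission
  imports Defs
begin

text \<open>
  The map $b \otimes x \mapsto \iota(b)\gamma(x)$ identifies $B \otimes C$ with $H$, and under this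
  identification \<open>\<zeta>\<close> becomes $\mathrm{id} \otimes \varepsilon$. On $\gamma(C)$ it is therefore the counit, and
  a failure of $\gamma(C)$ to respect product or coproduct is visible through \<open>\<zeta>\<close>. Each of the three
  conditions of the theorem turns out to be the conjunction of two equations:
  \<^item> \<open>comult_split\<close>: $\sum \zeta(\gamma(y)_{(1)}) \otimes \zeta(\gamma(y)_{(2)}) = \varepsilon(y)\, 1 \otimes 1$,
  \<^item> \<open>mult_split\<close>: $\zeta(\gamma(x)\gamma(y)) = \varepsilon(x)\varepsilon(y)\, 1$.

  The main tool is the reconstruction $h = \sum \iota(\zeta(h_{(1)}))\gamma(\pi(h_{(2)}))$. Inserting it
  in the second factor of \<open>comult_split\<close> removes that \<open>\<zeta>\<close>, because \<open>\<gamma>\<close> is $C$-colinear: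
  $\sum \zeta(\gamma(y)_{(1)}) \otimes \gamma(y)_{(2)} = 1 \otimes \gamma(y)$. Inserting it once more, in the
  first factor of $\Delta(\gamma(y))$, shows that this factor may be replaced by its image under
  $\gamma\pi$ (\<open>comult_gamma_left_in_range\<close>), that is, $\Delta(\gamma(C)) \subseteq \gamma(C) \otimes H$.
  With \<open>mult_split\<close> the same insertion applied to $\gamma(x)\gamma(y)$ shows that $\gamma(C)$ is closed
  under products (\<open>gamma_mult_in_range\<close>). The converse, from a right coideal subalgebra to the two
  equations, rests on $\zeta\gamma = \varepsilon$; the latter is forced by the convolution
  invertibility of \<open>\<gamma>\<close> (\<open>zeta_gamma_counit\<close>).

  On the dual side, $\zeta^*(B^*)$ is the annihilator of $\ker\zeta = \iota(B)\gamma(\ker\varepsilon)$.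
  It is a left coideal iff $\ker\zeta$ is a left ideal, which is \<open>mult_split\<close>. It is closed under
  products iff $(\zeta \otimes \zeta)\Delta$ vanishes on $\ker\zeta$; this contains \<open>comult_split\<close>,
  since $\gamma(y) - \varepsilon(y)1$ lies in $\ker\zeta$, and follows from the two equations together.

  The coefficients of $\boldsymbol\phi^{-1}$ with respect to the dual bases show that the associator
  is trivial iff $\sum \zeta(\gamma(x)\gamma(y)_{(1)}) \otimes \zeta(\gamma(y)_{(2)}) =
  \varepsilon(x)\varepsilon(y)\, 1 \otimes 1$. Taking $x = \pi(1)$ gives \<open>comult_split\<close>, applying
  $\varepsilon\iota$ to the second factor gives \<open>mult_split\<close>, and conversely the first factor of
  $\Delta(\gamma(y))$ can be moved into $\gamma(C)$, where \<open>mult_split\<close> applies. That triviality of the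
  associator is the same as triviality of its inverse rests on the left unit law of the smash product.

  A tensor is a functional on bilinear forms, so identities between Sweedler sums are proved after
  pairing with linear or multilinear forms; lemmas such as \<open>coassoc_form\<close> and \<open>counit_form\<close> are
  axioms paired in this way.
  A functional takes the value $0$ on an argument that is not multilinear, hence every
  rewriting step comes with linearity conditions.
\<close>

section \<open>Linear forms on subspaces and finite expansions of tensors\<close>

interpretation fscale: vector_space "fscale :: 'k::field \<Rightarrow> ('x \<Rightarrow> 'k) \<Rightarrow> 'x \<Rightarrow> 'k"
  by unfold_locales (auto simp: fscale_def fun_eq_iff algebra_simps)

lemma sum_fun_apply: "(\<Sum>i\<in>I. f i) x = (\<Sum>i\<in>I. f i x)" for f :: "'i \<Rightarrow> 'x \<Rightarrow> 'k::comm_monoid_add"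
  by (induction I rule: infinite_finite_induct) auto

text \<open>
  The carriers of duals and tensor products are proper subsets of function types, and on a form only
  its values on the carrier count. Closure of the carrier under the vector space operations is what
  makes restriction of forms to the carrier well behaved.
\<close>

definition closed_vspace :: "('k, 'a::ab_group_add) vspace \<Rightarrow> bool" where
  "closed_vspace V \<longleftrightarrow> (\<forall>x\<in>carr V. \<forall>y\<in>carr V. x + y \<in> carr V) \<and> (\<forall>c. \<forall>x\<in>carr V. scl V c x \<in> carr V)
     \<and> 0 \<in> carr V"

lemma whole_simps [simp]: "carr (whole s) = UNIV" "scl (whole s) = s"
  by (simp_all add: whole_def)

lemma dual_simps [simp]: "carr (dual s) = {f. Vector_Spaces.linear s (*) f}" "scl (dual s) = fscale"
  by (simp_all add: dual_def)

lemma scl_tensor_space [simp]: "scl (tensor_space V W) = fscale"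
  by (simp add: tensor_space_def)

lemma closed_whole [simp]: "closed_vspace (whole s)"
  by (simp add: closed_vspace_def)

lemma linear_scalar_iff:
  fixes s :: "'k::field \<Rightarrow> 'a::ab_group_add \<Rightarrow> 'a"
  assumes "vector_space s"
  shows "Vector_Spaces.linear s (*) f \<longleftrightarrow> (\<forall>x y. f (x + y) = f x + f y) \<and> (\<forall>c x. f (s c x) = c * f x)"
proof -
  have "vector_space ((*) :: 'k \<Rightarrow> 'k \<Rightarrow> 'k)" by unfold_locales (auto simp: algebra_simps)
  with assms show ?thesis
    by (simp add: Vector_Spaces.linear_iff)
qed

lemma linear_form_whole:
  "vector_space s \<Longrightarrow> linear_form (whole s) f \<longleftrightarrow> Vector_Spaces.linear s (*) f"
  by (auto simp: linear_scalar_iff linear_form_def)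

lemma closed_dual [simp]:
  assumes "vector_space s" shows "closed_vspace (dual s)"
  using assms by (simp add: closed_vspace_def linear_scalar_iff fscale_def algebra_simps)

lemma closed_tensor_space [simp]: "closed_vspace (tensor_space V W)"
  by (simp add: closed_vspace_def tensor_space_def tensor_span_def
      fscale.span_add fscale.span_scale fscale.span_zero)

lemma tensor_mem: "v \<in> carr V \<Longrightarrow> w \<in> carr W \<Longrightarrow> tensor V W v w \<in> carr (tensor_space V W)"
  by (auto simp: tensor_space_def tensor_span_def intro!: fscale.span_base)

text \<open>
  Every element of a span of pure tensors is a finite sum $\sum_i c_i\, x_i \otimes y_i$; the expansion
  works for all forms at once, and this turns questions about tensors into questions about finite sums.
  The scalars $c_i$ are kept separate because \<open>X\<close> and \<open>Y\<close> are arbitrary sets.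
\<close>

lemma tensor_span_expansion:
  fixes t :: "('k::field, 'a::ab_group_add, 'b::ab_group_add) tensor2"
  assumes "t \<in> tensor_span V W X Y"
  obtains n :: nat and c x y where "\<And>i. i < n \<Longrightarrow> x i \<in> X" "\<And>i. i < n \<Longrightarrow> y i \<in> Y"
    "\<And>\<beta>. bilinear_form V W \<beta> \<Longrightarrow> t \<beta> = (\<Sum>i<n. c i * \<beta> (x i) (y i))"
    "\<And>\<beta>. \<not> bilinear_form V W \<beta> \<Longrightarrow> t \<beta> = 0"
proof -
  define good where "good t \<longleftrightarrow> (\<exists>n::nat. \<exists>c x y. (\<forall>i<n. x i \<in> X \<and> y i \<in> Y) \<and>
    (\<forall>\<beta>. t \<beta> = (if bilinear_form V W \<beta> then (\<Sum>i<n. c i * \<beta> (x i) (y i)) else 0)))"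
    for t :: "('k, 'a, 'b) tensor2"
  have "good t" using assms unfolding tensor_span_def
  proof (induction rule: fscale.span_induct_alt)
    case base
    show ?case unfolding good_def by (intro exI[of _ 0]) auto
  next
    case (step d p u)
    obtain v w where p: "p = tensor V W v w" "v \<in> X" "w \<in> Y" using step by auto
    obtain n c x y where u: "\<forall>i<n::nat. x i \<in> X \<and> y i \<in> Y"
      "\<forall>\<beta>. u \<beta> = (if bilinear_form V W \<beta> then (\<Sum>i<n. c i * \<beta> (x i) (y i)) else 0)"
      using step unfolding good_def by blast
    have "(\<Sum>i<Suc n. (c(n := d)) i * \<beta> ((x(n := v)) i) ((y(n := w)) i)) =
      (\<Sum>i<n. c i * \<beta> (x i) (y i)) + d * \<beta> v w" for \<beta>
      unfolding sum.lessThan_Suc by (intro arg_cong2[where f = "(+)"] sum.cong refl) auto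
    then have "\<forall>\<beta>. (fscale d p + u) \<beta> = (if bilinear_form V W \<beta> then
        (\<Sum>i<Suc n. (c(n := d)) i * \<beta> ((x(n := v)) i) ((y(n := w)) i)) else 0)"
      using u p by (simp add: fscale_def tensor_def)
    moreover have "\<forall>i<Suc n. (x(n := v)) i \<in> X \<and> (y(n := w)) i \<in> Y"
      using u p by (simp add: less_Suc_eq)
    ultimately show ?case unfolding good_def
      by (intro exI[of _ "Suc n"] exI[of _ "c(n := d)"] exI[of _ "x(n := v)"] exI[of _ "y(n := w)"] conjI)
  qed
  then obtain n :: nat and c x y where t: "\<forall>i<n. x i \<in> X \<and> y i \<in> Y"
    "\<forall>\<beta>. t \<beta> = (if bilinear_form V W \<beta> then (\<Sum>i<n. c i * \<beta> (x i) (y i)) else 0)"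
    unfolding good_def by (elim exE conjE)
  show ?thesis by (rule that[of n x y c]) (simp_all add: t)
qed

lemma tensor_expansion:
  assumes "t \<in> carr (tensor_space V W)"
  obtains n :: nat and c x y where "\<And>i. i < n \<Longrightarrow> x i \<in> carr V" "\<And>i. i < n \<Longrightarrow> y i \<in> carr W"
    "\<And>\<beta>. bilinear_form V W \<beta> \<Longrightarrow> t \<beta> = (\<Sum>i<n. c i * \<beta> (x i) (y i))"
    "\<And>\<beta>. \<not> bilinear_form V W \<beta> \<Longrightarrow> t \<beta> = 0"
proof -
  have "t \<in> tensor_span V W (carr V) (carr W)" using assms by (simp add: tensor_space_def)
  then show ?thesis by (rule tensor_span_expansion) (rule that)
qed

lemma ttensor_expansion:
  fixes t :: "('k::field, 'a::ab_group_add, 'b::ab_group_add, 'c::ab_group_add) tensor3"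
  assumes "t \<in> carr (ttensor_space U V W)"
  obtains n :: nat and c x y z where "\<And>i. i < n \<Longrightarrow> x i \<in> carr U" "\<And>i. i < n \<Longrightarrow> y i \<in> carr V"
    "\<And>i. i < n \<Longrightarrow> z i \<in> carr W"
    "\<And>\<tau>. trilinear_form U V W \<tau> \<Longrightarrow> t \<tau> = (\<Sum>i<n. c i * \<tau> (x i) (y i) (z i))"
    "\<And>\<tau>. \<not> trilinear_form U V W \<tau> \<Longrightarrow> t \<tau> = 0"
proof -
  define good where "good t \<longleftrightarrow> (\<exists>n::nat. \<exists>c x y z. (\<forall>i<n. x i \<in> carr U \<and> y i \<in> carr V \<and> z i \<in> carr W) \<and>
    (\<forall>\<tau>. t \<tau> = (if trilinear_form U V W \<tau> then (\<Sum>i<n. c i * \<tau> (x i) (y i) (z i)) else 0)))"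
    for t :: "('k, 'a, 'b, 'c) tensor3"
  have "t \<in> fscale.span {ttensor U V W u v w | u v w. u \<in> carr U \<and> v \<in> carr V \<and> w \<in> carr W}"
    using assms by (simp add: ttensor_space_def)
  then have "good t"
  proof (induction rule: fscale.span_induct_alt)
    case base
    show ?case unfolding good_def by (intro exI[of _ 0]) auto
  next
    case (step d p q)
    obtain u v w where p: "p = ttensor U V W u v w" "u \<in> carr U" "v \<in> carr V" "w \<in> carr W"
      using step by auto
    obtain n c x y z where q: "\<forall>i<n::nat. x i \<in> carr U \<and> y i \<in> carr V \<and> z i \<in> carr W"
      "\<forall>\<tau>. q \<tau> = (if trilinear_form U V W \<tau> then (\<Sum>i<n. c i * \<tau> (x i) (y i) (z i)) else 0)"
      using step unfolding good_def by blast
    have "(\<Sum>i<Suc n. (c(n := d)) i * \<tau> ((x(n := u)) i) ((y(n := v)) i) ((z(n := w)) i)) =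
      (\<Sum>i<n. c i * \<tau> (x i) (y i) (z i)) + d * \<tau> u v w" for \<tau>
      unfolding sum.lessThan_Suc by (intro arg_cong2[where f = "(+)"] sum.cong refl) auto
    then have "\<forall>\<tau>. (fscale d p + q) \<tau> = (if trilinear_form U V W \<tau> then
        (\<Sum>i<Suc n. (c(n := d)) i * \<tau> ((x(n := u)) i) ((y(n := v)) i) ((z(n := w)) i)) else 0)"
      using p q by (simp add: fscale_def ttensor_def)
    moreover have "\<forall>i<Suc n. (x(n := u)) i \<in> carr U \<and> (y(n := v)) i \<in> carr V \<and> (z(n := w)) i \<in> carr W"
      using p q by (simp add: less_Suc_eq)
    ultimately show ?case unfolding good_def
      by (intro exI[of _ "Suc n"] exI[of _ "c(n := d)"] exI[of _ "x(n := u)"] exI[of _ "y(n := v)"]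
          exI[of _ "z(n := w)"] conjI)
  qed
  then obtain n :: nat and c x y z where t: "\<forall>i<n. x i \<in> carr U \<and> y i \<in> carr V \<and> z i \<in> carr W"
    "\<forall>\<tau>. t \<tau> = (if trilinear_form U V W \<tau> then (\<Sum>i<n. c i * \<tau> (x i) (y i) (z i)) else 0)"
    unfolding good_def by (elim exE conjE)
  show ?thesis by (rule that[of n x y z c]) (simp_all add: t)
qed

lemma linear_form_cong:
  assumes "closed_vspace V" "\<And>x. x \<in> carr V \<Longrightarrow> f x = g x"
  shows "linear_form V f \<longleftrightarrow> linear_form V g"
  using assms by (auto simp: linear_form_def closed_vspace_def)

lemma bilinear_form_cong:
  assumes "closed_vspace V" "closed_vspace W"
    and "\<And>v w. v \<in> carr V \<Longrightarrow> w \<in> carr W \<Longrightarrow> \<beta> v w = \<beta>' v w"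
  shows "bilinear_form V W \<beta> \<longleftrightarrow> bilinear_form V W \<beta>'"
  unfolding bilinear_form_def using assms
  by (intro conj_cong ball_cong linear_form_cong refl) auto

lemma trilinear_form_cong:
  assumes "closed_vspace U" "closed_vspace V" "closed_vspace W"
    and "\<And>u v w. u \<in> carr U \<Longrightarrow> v \<in> carr V \<Longrightarrow> w \<in> carr W \<Longrightarrow> \<tau> u v w = \<tau>' u v w"
  shows "trilinear_form U V W \<tau> \<longleftrightarrow> trilinear_form U V W \<tau>'"
  unfolding trilinear_form_def using assms
  by (intro conj_cong ball_cong linear_form_cong refl) auto

lemma tensor_cong:
  assumes "t \<in> carr (tensor_space V W)" "closed_vspace V" "closed_vspace W"
    and "\<And>v w. v \<in> carr V \<Longrightarrow> w \<in> carr W \<Longrightarrow> \<beta> v w = \<beta>' v w"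
  shows "t \<beta> = t \<beta>'"
proof -
  obtain n :: nat and c x y where t: "\<And>i. i < n \<Longrightarrow> x i \<in> carr V" "\<And>i. i < n \<Longrightarrow> y i \<in> carr W"
    "\<And>\<beta>. bilinear_form V W \<beta> \<Longrightarrow> t \<beta> = (\<Sum>i<n. c i * \<beta> (x i) (y i))"
    "\<And>\<beta>. \<not> bilinear_form V W \<beta> \<Longrightarrow> t \<beta> = 0"
    by (rule tensor_expansion[OF assms(1)]) (rule that)
  show ?thesis
    using bilinear_form_cong[OF assms(2,3), of \<beta> \<beta>'] assms(4) t
    by (cases "bilinear_form V W \<beta>") (auto intro!: sum.cong)
qed

lemma linear_form_scaled:
  "linear_form V f \<Longrightarrow> linear_form V (\<lambda>x. c * f x)" "linear_form V f \<Longrightarrow> linear_form V (\<lambda>x. f x * c)"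
  by (auto simp: linear_form_def algebra_simps)

lemma linear_form_zero [simp]: "linear_form V (\<lambda>x. 0)"
  by (auto simp: linear_form_def)

lemma linear_form_sum: "(\<And>i. i \<in> I \<Longrightarrow> linear_form V (f i)) \<Longrightarrow> linear_form V (\<lambda>x. \<Sum>i\<in>I. f i x)"
  by (auto simp: linear_form_def sum.distrib sum_distrib_left)

lemma tensor_not_bilinear: "t \<in> carr (tensor_space V W) \<Longrightarrow> \<not> bilinear_form V W \<beta> \<Longrightarrow> t \<beta> = 0"
  by (elim tensor_expansion)

lemma tensor_zero: "t \<in> carr (tensor_space V W) \<Longrightarrow> t (\<lambda>x y. 0) = 0"
  by (elim tensor_expansion) (auto simp: bilinear_form_def)

text \<open>
  Sweedler sums over a fixed tensor preserve linear dependence on a parameter. This is the step that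
  makes nested Sweedler sums admissible arguments of further tensors.
\<close>

lemma linear_form_tensor:
  assumes t: "t \<in> carr (tensor_space V W)" and U: "closed_vspace U"
    and lin: "\<And>v w. v \<in> carr V \<Longrightarrow> w \<in> carr W \<Longrightarrow> linear_form U (\<lambda>x. F x v w)"
    and bil: "\<And>x. x \<in> carr U \<Longrightarrow> bilinear_form V W (F x)"
  shows "linear_form U (\<lambda>x. t (F x))"
proof -
  obtain n :: nat and c x y where t: "\<And>i. i < n \<Longrightarrow> x i \<in> carr V" "\<And>i. i < n \<Longrightarrow> y i \<in> carr W"
    "\<And>\<beta>. bilinear_form V W \<beta> \<Longrightarrow> t \<beta> = (\<Sum>i<n. c i * \<beta> (x i) (y i))"
    "\<And>\<beta>. \<not> bilinear_form V W \<beta> \<Longrightarrow> t \<beta> = 0"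
    by (rule tensor_expansion[OF t]) (rule that)
  have "linear_form U (\<lambda>u. \<Sum>i<n. c i * F u (x i) (y i))"
    using t lin by (intro linear_form_sum linear_form_scaled) auto
  then show ?thesis
    by (subst linear_form_cong[OF U]) (auto simp: t bil)
qed

lemma tensor_scale:
  assumes "t \<in> carr (tensor_space V W)" "bilinear_form V W \<beta>"
  shows "t (\<lambda>x y. c * \<beta> x y) = c * t \<beta>"
proof -
  have "bilinear_form V W (\<lambda>x y. c * \<beta> x y)"
    using assms(2) by (auto simp: bilinear_form_def intro!: linear_form_scaled)
  then show ?thesis using assms
    by (elim tensor_expansion) (simp add: sum_distrib_left mult.left_commute)
qed

lemma tensor_sum:
  assumes "t \<in> carr (tensor_space V W)" "\<And>i. i \<in> I \<Longrightarrow> bilinear_form V W (\<beta> i)"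
  shows "t (\<lambda>x y. \<Sum>i\<in>I. \<beta> i x y) = (\<Sum>i\<in>I. t (\<beta> i))"
proof -
  have b: "bilinear_form V W (\<lambda>x y. \<Sum>i\<in>I. \<beta> i x y)"
    using assms(2) by (auto simp: bilinear_form_def intro!: linear_form_sum)
  from assms(1) show ?thesis
  proof (rule tensor_expansion)
    fix n :: nat and c x y
    assume *: "\<And>\<beta>. bilinear_form V W \<beta> \<Longrightarrow> t \<beta> = (\<Sum>i<n. c i * \<beta> (x i) (y i))"
    show ?thesis
      by (simp add: * b assms(2) sum_distrib_left) (rule sum.swap)
  qed
qed

lemma tensor_add:
  assumes t: "t \<in> carr (tensor_space V W)" and "bilinear_form V W \<beta>" "bilinear_form V W \<beta>'"
  shows "t (\<lambda>x y. \<beta> x y + \<beta>' x y) = t \<beta> + t \<beta>'"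
  using tensor_sum[OF t, of "{0, 1 :: nat}" "\<lambda>i. if i = 0 then \<beta> else \<beta>'"] assms by simp

section \<open>Linearity of maps built from Sweedler sums\<close>

abbreviation lin ::
  "('k::field \<Rightarrow> 'a::ab_group_add \<Rightarrow> 'a) \<Rightarrow> ('k \<Rightarrow> 'b::ab_group_add \<Rightarrow> 'b) \<Rightarrow> ('a \<Rightarrow> 'b) \<Rightarrow> bool" where
  "lin \<equiv> Vector_Spaces.linear"

text \<open>
  The rules below derive linearity from the shape of a term: a variable occurs exactly once in a
  multilinear expression, so at most one rule applies at each step and \<open>intro\<close> finds the derivation.
\<close>

lemma lin_compose: "lin s t f \<Longrightarrow> lin r s g \<Longrightarrow> lin r t (\<lambda>x. f (g x))"
  by (simp add: Vector_Spaces.linear_iff)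

lemma lin_scalar_mult:
  "lin r (*) f \<Longrightarrow> lin r (*) (\<lambda>x. f x * c)" "lin r (*) f \<Longrightarrow> lin r (*) (\<lambda>x. c * f x)"
  for c :: "'k::field"
  by (simp_all add: Vector_Spaces.linear_iff algebra_simps)

lemma lin_scale:
  "vector_space s \<Longrightarrow> lin r (*) f \<Longrightarrow> lin r s (\<lambda>x. s (f x) v)"
  "vector_space s \<Longrightarrow> lin r s g \<Longrightarrow> lin r s (\<lambda>x. s c (g x))"
  by (simp_all add: Vector_Spaces.linear_iff vector_space_def mult.commute)

lemma lin_algebra_mult:
  assumes "algebra_over s"
  shows "lin r s f \<Longrightarrow> lin r s (\<lambda>x. f x * c)" "lin r s f \<Longrightarrow> lin r s (\<lambda>x. c * f x)"
proof -
  interpret algebra_over s by fact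
  show "lin r s f \<Longrightarrow> lin r s (\<lambda>x. f x * c)" "lin r s f \<Longrightarrow> lin r s (\<lambda>x. c * f x)"
    by (simp_all add: Vector_Spaces.linear_iff distrib_left distrib_right scale_mult_left scale_mult_right)
qed

lemma lin_tensor_argument: "lin s fscale \<Delta> \<Longrightarrow> lin r s f \<Longrightarrow> lin r (*) (\<lambda>x. \<Delta> (f x) \<beta>)"
  for \<Delta> :: "'a::ab_group_add \<Rightarrow> 'x \<Rightarrow> 'k::field"
  by (simp add: Vector_Spaces.linear_iff linear_scalar_iff fscale_def algebra_simps)
    (unfold_locales, simp_all add: algebra_simps)

lemma bilinear_form_wholeI:
  assumes "vector_space s" "vector_space t"
    and "\<And>w. lin s (*) (\<lambda>v. \<beta> v w)" "\<And>v. lin t (*) (\<lambda>w. \<beta> v w)"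
  shows "bilinear_form (whole s) (whole t) \<beta>"
  using assms by (simp add: bilinear_form_def linear_form_whole)

lemma lin_tensor_form:
  assumes "t \<in> carr (tensor_space (whole s) (whole s'))" "vector_space r" "vector_space s" "vector_space s'"
    and "\<And>v w. lin r (*) (\<lambda>x. F x v w)"
    and "\<And>x w. lin s (*) (\<lambda>v. F x v w)" "\<And>x v. lin s' (*) (\<lambda>w. F x v w)"
  shows "lin r (*) (\<lambda>x. t (F x))"
proof -
  have "linear_form (whole r) (\<lambda>x. t (F x))"
    using assms by (intro linear_form_tensor[OF assms(1)] bilinear_form_wholeI) (simp_all add: linear_form_whole)
  then show ?thesis using assms(2) by (simp add: linear_form_whole)
qed

text \<open>
  If $u \neq v$, extend $u - v$ to a basis: the coordinate at $u - v$ is a form that tells \<open>u\<close> from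
  \<open>v\<close>. Equations in $H$, $B$ and $C$ are proved through this lemma.
\<close>

lemma forms_separate:
  assumes "vector_space s" and eq: "\<And>\<phi>. lin s (*) \<phi> \<Longrightarrow> \<phi> u = \<phi> v"
  shows "u = v"
proof (rule ccontr)
  interpret vector_space s by fact
  assume "u \<noteq> v"
  define E where "E = extend_basis {u - v}"
  have ind: "independent {u - v}" using \<open>u \<noteq> v\<close> by (simp add: dependent_single)
  have E: "independent E" "span E = UNIV" "u - v \<in> E"
    using independent_extend_basis[OF ind] span_extend_basis[OF ind] extend_basis_superset[OF ind]
    by (auto simp: E_def)
  have "representation E u (u - v) = representation E v (u - v)"
    by (rule eq) (rule linear_representation[OF E(1,2)])
  moreover have "representation E (u - v) (u - v) = representation E u (u - v) - representation E v (u - v)"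
    using E by (simp add: representation_diff)
  moreover have "representation E (u - v) (u - v) = 1"
    using E by (simp add: representation_basis)
  ultimately show False by simp
qed

text \<open>
  This justifies the definite description behind \<open>sweedler\<close>: a finite expansion of \<open>t\<close> provides a
  vector with the required pairings, and linear forms separate vectors.
\<close>

lemma form_sweedler:
  assumes t: "t \<in> carr (tensor_space (whole s1) (whole s2))"
    and vs: "vector_space s1" "vector_space s2" "vector_space s"
    and F: "\<And>y. lin s1 s (\<lambda>x. F x y)" "\<And>x. lin s2 s (\<lambda>y. F x y)"
    and \<phi>: "lin s (*) \<phi>"
  shows "\<phi> (sweedler s t F) = t (\<lambda>x y. \<phi> (F x y))"
proof -
  interpret vector_space s by fact
  have bil: "bilinear_form (whole s1) (whole s2) (\<lambda>x y. \<psi> (F x y))" if "lin s (*) \<psi>" for \<psi>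
    by (intro bilinear_form_wholeI vs lin_compose[OF that] F)
  obtain n :: nat and c x y where
    "\<And>i. i < n \<Longrightarrow> x i \<in> carr (whole s1)" "\<And>i. i < n \<Longrightarrow> y i \<in> carr (whole s2)"
    and exp: "\<And>\<beta>. bilinear_form (whole s1) (whole s2) \<beta> \<Longrightarrow> t \<beta> = (\<Sum>i<n. c i * \<beta> (x i) (y i))"
    and "\<And>\<beta>. \<not> bilinear_form (whole s1) (whole s2) \<beta> \<Longrightarrow> t \<beta> = 0"
    by (rule tensor_expansion[OF t]) (rule that)
  define u where "u = (\<Sum>i<n. s (c i) (F (x i) (y i)))"
  have sum: "\<psi> (\<Sum>i\<in>I. f i) = (\<Sum>i\<in>I. \<psi> (f i))" if "lin s (*) \<psi>" for \<psi> and I :: "nat set" and f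
  proof -
    interpret \<psi>: Vector_Spaces.linear s "(*)" \<psi> by fact
    show ?thesis by (rule \<psi>.sum)
  qed
  have u: "\<psi> u = t (\<lambda>x y. \<psi> (F x y))" if "lin s (*) \<psi>" for \<psi>
    using that by (simp add: exp[OF bil[OF that]] u_def sum[OF that] linear_scalar_iff[OF vs(3)])
  have "sweedler s t F = u"
    unfolding sweedler_def
  proof (rule the_equality)
    show "\<forall>\<phi>\<in>carr (dual s). \<phi> u = t (\<lambda>x y. \<phi> (F x y))" using u by simp
  next
    fix u' assume "\<forall>\<phi>\<in>carr (dual s). \<phi> u' = t (\<lambda>x y. \<phi> (F x y))"
    then show "u' = u" using u by (intro forms_separate[OF vs(3)]) simp
  qed
  then show ?thesis using u[OF \<phi>] by simp
qed

context coalgebra_over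
begin

lemma lin_comult:
  "lin r s f \<Longrightarrow> lin r (*) (\<lambda>x. \<Delta> (f x) \<beta>)"
  "vector_space r \<Longrightarrow> (\<And>v w. lin r (*) (\<lambda>x. F x v w)) \<Longrightarrow> (\<And>x w. lin s (*) (\<lambda>v. F x v w)) \<Longrightarrow>
    (\<And>x v. lin s (*) (\<lambda>w. F x v w)) \<Longrightarrow> lin r (*) (\<lambda>x. \<Delta> h (F x))"
  using lin_tensor_argument[OF comult_linear] lin_tensor_form[OF comult_closed] vector_space_axioms
  by blast+

lemma lin_counit: "lin r s f \<Longrightarrow> lin r (*) (\<lambda>x. \<epsilon> (f x))"
  by (rule lin_compose[OF counit_linear])

lemma comult_scale:
  assumes "\<And>w. lin s (*) (\<lambda>v. \<beta> v w)" "\<And>v. lin s (*) (\<lambda>w. \<beta> v w)"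
  shows "\<Delta> x (\<lambda>a b. c * \<beta> a b) = c * \<Delta> x \<beta>" "\<Delta> x (\<lambda>a b. \<beta> a b * c) = \<Delta> x \<beta> * c"
  using tensor_scale[OF comult_closed bilinear_form_wholeI[OF vector_space_axioms vector_space_axioms assms]]
  by (simp_all add: mult.commute[of _ c])

lemma coassoc_form:
  assumes "\<And>b c. lin s (*) (\<lambda>a. \<tau> a b c)" "\<And>a c. lin s (*) (\<lambda>b. \<tau> a b c)" "\<And>a b. lin s (*) (\<lambda>c. \<tau> a b c)"
  shows "\<Delta> x (\<lambda>x1 x2. \<Delta> x1 (\<lambda>u v. \<tau> u v x2)) = \<Delta> x (\<lambda>x1 x2. \<Delta> x2 (\<lambda>u v. \<tau> x1 u v))"
proof -
  have "trilinear_form (whole s) (whole s) (whole s) \<tau>"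
    using assms by (simp add: trilinear_form_def linear_form_whole[OF vector_space_axioms])
  then show ?thesis using fun_cong[OF coassoc[of x], of \<tau>] by (simp add: ttensor_def)
qed

lemma counit_form:
  assumes "lin s (*) \<phi>"
  shows "\<Delta> x (\<lambda>a b. \<epsilon> a * \<phi> b) = \<phi> x" "\<Delta> x (\<lambda>a b. \<phi> a * \<epsilon> b) = \<phi> x"
proof -
  note form = form_sweedler[OF comult_closed vector_space_axioms vector_space_axioms vector_space_axioms _ _ assms]
  have *: "\<phi> (s c v) = c * \<phi> v" for c v using assms by (simp add: linear_scalar_iff[OF vector_space_axioms])
  have "\<phi> (sweedler s (\<Delta> x) (\<lambda>a b. s (\<epsilon> a) b)) = \<Delta> x (\<lambda>a b. \<phi> (s (\<epsilon> a) b))"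
    by (intro form lin_scale lin_counit linear_ident vector_space_axioms)
  then show "\<Delta> x (\<lambda>a b. \<epsilon> a * \<phi> b) = \<phi> x" by (simp add: counit_left *)
  have "\<phi> (sweedler s (\<Delta> x) (\<lambda>a b. s (\<epsilon> b) a)) = \<Delta> x (\<lambda>a b. \<phi> (s (\<epsilon> b) a))"
    by (intro form lin_scale lin_counit linear_ident vector_space_axioms)
  then show "\<Delta> x (\<lambda>a b. \<phi> a * \<epsilon> b) = \<phi> x" by (simp add: counit_right * mult.commute)
qed

end

lemma
  assumes "finite_dimensional_vector_space s E"
  shows lin_coordinate: "lin r s f \<Longrightarrow> lin r (*) (\<lambda>x. module.representation s E (f x) e)"
    and form_coordinates: "lin s (*) \<phi> \<Longrightarrow> \<phi> x = (\<Sum>e\<in>E. module.representation s E x e * \<phi> e)"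
proof -
  interpret finite_dimensional_vector_space s E by fact
  show "lin r (*) (\<lambda>x. representation E (f x) e)" if "lin r s f"
    by (rule lin_compose[OF linear_representation that]) (simp_all add: independent_Basis span_Basis)
  assume \<phi>: "lin s (*) \<phi>"
  interpret \<phi>: Vector_Spaces.linear s "(*)" \<phi> by fact
  have "x = (\<Sum>e\<in>E. s (representation E x e) e)"
    by (rule sum_representation_eq[symmetric]) (simp_all add: independent_Basis span_Basis finite_Basis)
  then have "\<phi> x = \<phi> (\<Sum>e\<in>E. s (representation E x e) e)" by simp
  then show "\<phi> x = (\<Sum>e\<in>E. representation E x e * \<phi> e)"
    by (simp add: \<phi>.sum \<phi>.scale)
qed

section \<open>The product decomposition of the Hopf algebra\<close>

context partially_admissible_mapping_system
begin

lemmas vector_spaces = vector_space_axioms B.vector_space_axioms C.vector_space_axioms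

text \<open>
  Instances with the source fixed to one of the three spaces, so that resolution meets no
  schematic scalar multiplication in the premises.
\<close>

lemmas lin_intros =
  lin_comult(1)[of sH] lin_comult(1)[of sB] lin_comult(1)[of sC]
  lin_comult(2)[of sH] lin_comult(2)[of sB] lin_comult(2)[of sC]
  C.lin_comult(1)[of sH] C.lin_comult(1)[of sB] C.lin_comult(1)[of sC]
  C.lin_comult(2)[of sH] C.lin_comult(2)[of sB] C.lin_comult(2)[of sC]
  lin_tensor_argument[OF coaction_linear]
  lin_tensor_form[OF coaction_closed]
  lin_counit C.lin_counit
  lin_compose[OF iota_linear] lin_compose[OF pi_linear] lin_compose[OF zeta_linear] lin_compose[OF gamma_linear]
  lin_compose[OF act_linear_left] lin_compose[OF act_linear_right]
  lin_algebra_mult[OF algebra_over_axioms] lin_algebra_mult[OF B.algebra_over_axioms]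
  lin_scalar_mult lin_scale linear_ident B.linear_ident C.linear_ident vector_spaces

lemma form_eqI:
  "(\<And>\<phi>. lin sH (*) \<phi> \<Longrightarrow> \<phi> h = \<phi> h') \<Longrightarrow> h = h'"
  "(\<And>\<psi>. lin sB (*) \<psi> \<Longrightarrow> \<psi> b = \<psi> b') \<Longrightarrow> b = b'"
  "(\<And>\<chi>. lin sC (*) \<chi> \<Longrightarrow> \<chi> c = \<chi> c') \<Longrightarrow> c = c'"
  using forms_separate vector_spaces by metis+

lemma form_scale:
  "lin sH (*) \<phi> \<Longrightarrow> \<phi> (sH c h) = c * \<phi> h" "lin sB (*) \<psi> \<Longrightarrow> \<psi> (sB c b) = c * \<psi> b"
  "lin sC (*) \<chi> \<Longrightarrow> \<chi> (sC c x) = c * \<chi> x"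
  by (simp_all add: Vector_Spaces.linear_iff)

lemma decomposition_form:
  assumes "lin sH (*) \<phi>"
  shows "\<Delta>H h (\<lambda>a b. \<phi> (\<iota> (\<zeta> a) * \<gamma> (\<pi> b))) = \<phi> h"
proof -
  have "\<phi> (sweedler sH (\<Delta>H h) (\<lambda>a b. \<iota> (\<zeta> a) * \<gamma> (\<pi> b))) = \<Delta>H h (\<lambda>a b. \<phi> (\<iota> (\<zeta> a) * \<gamma> (\<pi> b)))"
    by (intro form_sweedler[OF comult_closed] assms lin_intros)
  then show ?thesis by (simp add: zeta_gamma)
qed

lemma comult_mult_form:
  assumes "\<And>b. lin sH (*) (\<lambda>a. \<beta> a b)" "\<And>a. lin sH (*) (\<lambda>b. \<beta> a b)"
  shows "\<Delta>H (h * k) \<beta> = \<Delta>H h (\<lambda>a b. \<Delta>H k (\<lambda>c d. \<beta> (a * c) (b * d)))"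
  using bilinear_form_wholeI[OF vector_spaces(1,1) assms] by (simp add: comult_mult tensor_def)

lemma comult_one_form:
  assumes "\<And>b. lin sH (*) (\<lambda>a. \<beta> a b)" "\<And>a. lin sH (*) (\<lambda>b. \<beta> a b)"
  shows "\<Delta>H 1 \<beta> = \<beta> 1 1"
  using bilinear_form_wholeI[OF vector_spaces(1,1) assms] by (simp add: comult_one tensor_def)

lemma comult_gamma_form:
  assumes "\<And>b. lin sH (*) (\<lambda>a. \<beta> a b)" "\<And>a. lin sC (*) (\<lambda>b. \<beta> a b)"
  shows "\<Delta>H (\<gamma> x) (\<lambda>a b. \<beta> a (\<pi> b)) = \<Delta>C x (\<lambda>a b. \<beta> (\<gamma> a) b)"
  using bilinear_form_wholeI[OF vector_spaces(1,3) assms] fun_cong[OF gamma_comodule_map[of x], of \<beta>]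
  by (simp add: tensor_map_def tensor_def)

lemma counit_pi_one: "\<epsilon>C (\<pi> 1) = 1"
  by (simp add: pi_counit counit_one)

lemma pi_gamma: "\<pi> (\<gamma> x) = x"
proof (rule form_eqI)
  fix \<chi> assume \<chi>: "lin sC (*) \<chi>"
  have "\<chi> (\<pi> (\<gamma> x)) = \<Delta>H (\<gamma> x) (\<lambda>a b. \<epsilon>H a * \<chi> (\<pi> b))"
    by (subst counit_form) (intro lin_intros lin_compose[OF \<chi>] refl)+
  also have "\<dots> = \<Delta>C x (\<lambda>a b. \<epsilon>H (\<gamma> a) * \<chi> b)"
    by (intro comult_gamma_form lin_intros lin_compose[OF \<chi>])
  also have "\<dots> = \<chi> x"
    by (simp add: counit_gamma C.counit_form \<chi>)
  finally show "\<chi> (\<pi> (\<gamma> x)) = \<chi> x" .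
qed

text \<open>
  The reconstruction formula evaluated at $\gamma(x)$ says $(\iota\zeta\gamma) * \gamma = \gamma$ for the
  convolution product. Cancelling the invertible \<open>\<gamma>\<close> leaves the convolution unit $\varepsilon(-)1$, and
  \<open>\<iota>\<close> is injective.
\<close>

lemma zeta_gamma_counit: "\<zeta> (\<gamma> x) = sB (\<epsilon>C x) 1"
proof -
  obtain g where g: "lin sC sH g" "\<And>x. convolution \<Delta>C sH \<gamma> g x = sH (\<epsilon>C x) 1"
    using gamma_invertible unfolding convolution_invertible_def by blast
  have \<gamma>g: "\<Delta>C x (\<lambda>a b. \<phi> (\<gamma> a * g b)) = \<epsilon>C x * \<phi> 1" if \<phi>: "lin sH (*) \<phi>" for \<phi> x
  proof -
    have "\<phi> (convolution \<Delta>C sH \<gamma> g x) = \<Delta>C x (\<lambda>a b. \<phi> (\<gamma> a * g b))"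
      unfolding convolution_def
      by (intro form_sweedler[OF C.comult_closed] \<phi> lin_intros lin_compose[OF g(1)])
    then show ?thesis by (simp add: g form_scale(1)[OF \<phi>])
  qed
  have absorb: "\<Delta>C x (\<lambda>a b. \<phi> (\<iota> (\<zeta> (\<gamma> a)) * \<gamma> b)) = \<phi> (\<gamma> x)" if \<phi>: "lin sH (*) \<phi>" for \<phi> x
  proof -
    have "\<Delta>C x (\<lambda>a b. \<phi> (\<iota> (\<zeta> (\<gamma> a)) * \<gamma> b)) = \<Delta>H (\<gamma> x) (\<lambda>a b. \<phi> (\<iota> (\<zeta> a) * \<gamma> (\<pi> b)))"
      by (rule comult_gamma_form[symmetric]) (intro lin_intros lin_compose[OF \<phi>])+
    then show ?thesis by (simp add: decomposition_form[OF \<phi>])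
  qed
  have "\<iota> (\<zeta> (\<gamma> x)) = sH (\<epsilon>C x) 1"
  proof (rule form_eqI)
    fix \<phi> assume \<phi>: "lin sH (*) \<phi>"
    have "\<phi> (\<iota> (\<zeta> (\<gamma> x))) = \<Delta>C x (\<lambda>a b. \<phi> (\<iota> (\<zeta> (\<gamma> a))) * \<epsilon>C b)"
      by (rule C.counit_form[symmetric]) (intro lin_intros lin_compose[OF \<phi>])
    also have "\<dots> = \<Delta>C x (\<lambda>a b. \<Delta>C b (\<lambda>c d. \<phi> (\<iota> (\<zeta> (\<gamma> a)) * (\<gamma> c * g d))))"
      by (subst \<gamma>g) (intro lin_intros lin_compose[OF \<phi>], simp add: mult.commute)
    also have "\<dots> = \<Delta>C x (\<lambda>a b. \<Delta>C a (\<lambda>c d. \<phi> (\<iota> (\<zeta> (\<gamma> c)) * (\<gamma> d * g b))))"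
      by (rule C.coassoc_form[symmetric]) (intro lin_intros lin_compose[OF \<phi>] lin_compose[OF g(1)])+
    also have "\<dots> = \<Delta>C x (\<lambda>a b. \<Delta>C a (\<lambda>c d. \<phi> (\<iota> (\<zeta> (\<gamma> c)) * \<gamma> d * g b)))"
      by (simp add: mult.assoc)
    also have "\<dots> = \<Delta>C x (\<lambda>a b. \<phi> (\<gamma> a * g b))"
      by (subst absorb) (intro lin_intros lin_compose[OF \<phi>], simp)
    also have "\<dots> = \<phi> (sH (\<epsilon>C x) 1)"
      by (simp add: \<gamma>g[OF \<phi>] form_scale(1)[OF \<phi>])
    finally show "\<phi> (\<iota> (\<zeta> (\<gamma> x))) = \<phi> (sH (\<epsilon>C x) 1)" .
  qed
  also have "\<dots> = \<iota> (sB (\<epsilon>C x) 1)"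
    using iota_linear by (simp add: Vector_Spaces.linear_iff iota_one)
  finally show ?thesis using iota_inj by (simp add: inj_eq)
qed

text \<open>
  $C$ is spanned by the image under \<open>\<pi>\<close> of a finite basis of $H$, and a spanning set contains a basis.
\<close>

lemma finite_dimensional_C: "\<exists>E. finite_dimensional_vector_space sC E"
proof -
  obtain E where E: "finite_dimensional_vector_space sH E" using finite_dimensional by blast
  interpret HE: finite_dimensional_vector_space sH E by (rule E)
  interpret \<pi>: Vector_Spaces.linear sH sC \<pi> by (rule pi_linear)
  obtain F where F: "F \<subseteq> \<pi> ` E" "C.independent F" "\<pi> ` E \<subseteq> C.span F"
    by (rule C.maximal_independent_subset)
  have "C.span (\<pi> ` E) = \<pi> ` span E" by (rule \<pi>.span_image)
  also have "\<dots> = UNIV" using pi_surj by (simp add: HE.span_Basis)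
  finally have "C.span F = UNIV"
    using C.span_mono[OF F(3)] by (simp add: C.span_span top.extremum_unique)
  moreover have "finite F" using F(1) HE.finite_Basis by (meson finite_imageI finite_subset)
  ultimately show ?thesis
    using F(2) by (intro exI[of _ F]) unfold_locales
qed

end

section \<open>Sections compatible with products and coproducts\<close>

context partially_admissible_mapping_system
begin

text \<open>
  The equation $\sum \zeta(\gamma(y)_{(1)}) \otimes \zeta(\gamma(y)_{(2)}) = \varepsilon(y)\,1 \otimes 1$ in
  $B \otimes B$, tested on product forms $\varphi \otimes \psi$.
\<close>

definition comult_split :: bool where
  "comult_split \<longleftrightarrow> (\<forall>\<phi> \<psi> y. lin sB (*) \<phi> \<longrightarrow> lin sB (*) \<psi> \<longrightarrow>
     \<Delta>H (\<gamma> y) (\<lambda>a b. \<phi> (\<zeta> a) * \<psi> (\<zeta> b)) = \<epsilon>C y * (\<phi> 1 * \<psi> 1))"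

definition mult_split :: bool where
  "mult_split \<longleftrightarrow> (\<forall>x y. \<zeta> (\<gamma> x * \<gamma> y) = sB (\<epsilon>C x * \<epsilon>C y) 1)"

text \<open>
  Writing the second factor as $\sum\iota(\zeta(b_{(1)}))\gamma(\pi(b_{(2)}))$ and using coassociativity
  produces $\sum \zeta(\gamma(y)_{(1)}) \otimes \zeta(\gamma(y)_{(2)})$ next to $\pi(\gamma(y)_{(3)})$, and
  colinearity of \<open>\<gamma>\<close> splits off the last factor.
\<close>

lemma comult_gamma_zeta_left_product:
  assumes "comult_split" and \<phi>: "lin sB (*) \<phi>" and \<chi>: "lin sH (*) \<chi>"
  shows "\<Delta>H (\<gamma> y) (\<lambda>a b. \<phi> (\<zeta> a) * \<chi> b) = \<phi> 1 * \<chi> (\<gamma> y)"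
proof -
  note intros = lin_intros lin_compose[OF \<phi>] lin_compose[OF \<chi>]
  have "\<Delta>H (\<gamma> y) (\<lambda>a b. \<phi> (\<zeta> a) * \<chi> b) =
      \<Delta>H (\<gamma> y) (\<lambda>a b. \<Delta>H b (\<lambda>c d. \<phi> (\<zeta> a) * \<chi> (\<iota> (\<zeta> c) * \<gamma> (\<pi> d))))"
    by (subst comult_scale) (intro intros, simp add: decomposition_form[OF \<chi>])+
  also have "\<dots> = \<Delta>H (\<gamma> y) (\<lambda>a b. \<Delta>H a (\<lambda>c d. \<phi> (\<zeta> c) * \<chi> (\<iota> (\<zeta> d) * \<gamma> (\<pi> b))))"
    by (rule coassoc_form[symmetric]) (intro intros)+
  also have "\<dots> = \<Delta>C y (\<lambda>a b. \<Delta>H (\<gamma> a) (\<lambda>c d. \<phi> (\<zeta> c) * \<chi> (\<iota> (\<zeta> d) * \<gamma> b)))"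
    by (rule comult_gamma_form) (intro intros)+
  also have "\<dots> = \<Delta>C y (\<lambda>a b. \<epsilon>C a * (\<phi> 1 * \<chi> (\<gamma> b)))"
  proof -
    have "\<Delta>H (\<gamma> a) (\<lambda>c d. \<phi> (\<zeta> c) * \<chi> (\<iota> (\<zeta> d) * \<gamma> b)) = \<epsilon>C a * (\<phi> 1 * \<chi> (\<gamma> b))" for a b
    proof -
      have "lin sB (*) (\<lambda>u. \<chi> (\<iota> u * \<gamma> b))" by (intro intros)
      then show ?thesis
        using \<open>comult_split\<close>[unfolded comult_split_def, rule_format, of \<phi> "\<lambda>u. \<chi> (\<iota> u * \<gamma> b)" a] \<phi>
        by (simp add: iota_one)
    qed
    then show ?thesis by simp
  qed
  also have "\<dots> = \<phi> 1 * \<chi> (\<gamma> y)"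
    by (rule C.counit_form) (intro intros)
  finally show ?thesis .
qed

text \<open>
  The passage from product forms to all bilinear forms expands the first argument in a basis of $H$.
  The form is taken on $H \times H$ and \<open>\<iota>\<close> is inserted so that this basis serves and none of $B$ is
  involved.
\<close>

lemma comult_gamma_zeta_left:
  assumes "comult_split"
    and \<beta>: "\<And>b. lin sH (*) (\<lambda>a. \<beta> a b)" "\<And>a. lin sH (*) (\<lambda>b. \<beta> a b)"
  shows "\<Delta>H (\<gamma> y) (\<lambda>a b. \<beta> (\<iota> (\<zeta> a)) b) = \<beta> 1 (\<gamma> y)"
proof -
  obtain E where E: "finite_dimensional_vector_space sH E" using finite_dimensional by blast
  define r where "r e h = module.representation sH E h e" for e h
  have r: "lin sH (*) (\<lambda>h. r e h)" for e
    unfolding r_def by (intro lin_coordinate[OF E] lin_intros)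
  have exp: "\<beta> a b = (\<Sum>e\<in>E. r e a * \<beta> e b)" for a b
    unfolding r_def by (rule form_coordinates[OF E \<beta>(1)])
  have "\<Delta>H (\<gamma> y) (\<lambda>a b. \<beta> (\<iota> (\<zeta> a)) b) = \<Delta>H (\<gamma> y) (\<lambda>a b. \<Sum>e\<in>E. r e (\<iota> (\<zeta> a)) * \<beta> e b)"
    by (subst exp) (rule refl)
  also have "\<dots> = (\<Sum>e\<in>E. \<Delta>H (\<gamma> y) (\<lambda>a b. r e (\<iota> (\<zeta> a)) * \<beta> e b))"
    by (intro tensor_sum[OF comult_closed] bilinear_form_wholeI lin_intros lin_compose[OF r] \<beta>)
  also have "\<dots> = (\<Sum>e\<in>E. r e 1 * \<beta> e (\<gamma> y))"
  proof (rule sum.cong[OF refl])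
    fix e
    have "lin sB (*) (\<lambda>u. r e (\<iota> u))" by (intro lin_intros lin_compose[OF r])
    from comult_gamma_zeta_left_product[OF assms(1) this \<beta>(2)]
    show "\<Delta>H (\<gamma> y) (\<lambda>a b. r e (\<iota> (\<zeta> a)) * \<beta> e b) = r e 1 * \<beta> e (\<gamma> y)"
      by (simp add: iota_one)
  qed
  also have "\<dots> = \<beta> 1 (\<gamma> y)" by (rule exp[symmetric])
  finally show ?thesis .
qed

text \<open>
  Reconstruct the first factor as $\sum\iota(\zeta(a_{(1)}))\gamma(\pi(a_{(2)}))$; after reassociation the
  $\zeta$-part is $1$ by the previous lemma. The bilinear form used there is itself a Sweedler sum and
  no product form, which is why the previous lemma is stated for all bilinear forms.
\<close>

lemma comult_gamma_left_in_range:
  assumes "comult_split"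
    and \<beta>: "\<And>b. lin sH (*) (\<lambda>a. \<beta> a b)" "\<And>a. lin sH (*) (\<lambda>b. \<beta> a b)"
  shows "\<Delta>H (\<gamma> y) (\<lambda>a b. \<beta> (\<gamma> (\<pi> a)) b) = \<Delta>H (\<gamma> y) \<beta>"
proof -
  note intros = lin_intros lin_compose[OF \<beta>(1)] lin_compose[OF \<beta>(2)] \<beta>
  have "\<Delta>H (\<gamma> y) \<beta> = \<Delta>H (\<gamma> y) (\<lambda>a b. \<Delta>H a (\<lambda>c d. \<beta> (\<iota> (\<zeta> c) * \<gamma> (\<pi> d)) b))"
    by (subst decomposition_form[OF \<beta>(1)]) (rule refl)
  also have "\<dots> = \<Delta>H (\<gamma> y) (\<lambda>a b. \<Delta>H b (\<lambda>c d. \<beta> (\<iota> (\<zeta> a) * \<gamma> (\<pi> c)) d))"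
    by (rule coassoc_form) (intro intros)+
  also have "\<dots> = \<Delta>H (\<gamma> y) (\<lambda>c d. \<beta> (1 * \<gamma> (\<pi> c)) d)"
    by (rule comult_gamma_zeta_left[OF assms(1)]) (intro intros)+
  finally show ?thesis by simp
qed

text \<open>
  In the reconstruction of $\gamma(x)\gamma(y)$ the $\zeta$-part is $\zeta(\gamma(x_{(1)})\gamma(y)_{(1)})$, since
  \<open>\<gamma>\<close> is colinear and \<open>\<pi>\<close> is $H$-linear. As $\gamma(y)_{(1)}$ may be taken in $\gamma(C)$, this part
  is scalar.
\<close>

lemma gamma_mult_in_range:
  assumes "comult_split" "mult_split"
  shows "\<gamma> x * \<gamma> y = \<gamma> (\<pi> (\<gamma> x * \<gamma> y))"
proof (rule form_eqI)
  fix \<phi> assume \<phi>: "lin sH (*) \<phi>"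
  note intros = lin_intros lin_compose[OF \<phi>]
  have "\<phi> (\<gamma> x * \<gamma> y) = \<Delta>H (\<gamma> x * \<gamma> y) (\<lambda>a b. \<phi> (\<iota> (\<zeta> a) * \<gamma> (\<pi> b)))"
    by (rule decomposition_form[OF \<phi>, symmetric])
  also have "\<dots> = \<Delta>H (\<gamma> x) (\<lambda>a b. \<Delta>H (\<gamma> y) (\<lambda>c d. \<phi> (\<iota> (\<zeta> (a * c)) * \<gamma> (act (\<pi> b) d))))"
    by (subst comult_mult_form) (intro intros | simp add: pi_module_map)+
  also have "\<dots> = \<Delta>C x (\<lambda>a b. \<Delta>H (\<gamma> y) (\<lambda>c d. \<phi> (\<iota> (\<zeta> (\<gamma> a * c)) * \<gamma> (act b d))))"
    by (rule comult_gamma_form) (intro intros)+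
  also have "\<dots> = \<Delta>C x (\<lambda>a b. \<Delta>H (\<gamma> y) (\<lambda>c d. \<phi> (\<iota> (\<zeta> (\<gamma> a * \<gamma> (\<pi> c))) * \<gamma> (act b d))))"
  proof -
    have "\<Delta>H (\<gamma> y) (\<lambda>c d. \<phi> (\<iota> (\<zeta> (\<gamma> a * \<gamma> (\<pi> c))) * \<gamma> (act b d))) =
        \<Delta>H (\<gamma> y) (\<lambda>c d. \<phi> (\<iota> (\<zeta> (\<gamma> a * c)) * \<gamma> (act b d)))" for a b
      by (rule comult_gamma_left_in_range[OF assms(1)]) (intro intros)+
    then show ?thesis by simp
  qed
  also have "\<dots> = \<Delta>C x (\<lambda>a b. \<Delta>H (\<gamma> y) (\<lambda>c d. \<epsilon>H c * (\<epsilon>C a * \<phi> (\<gamma> (act b d)))))"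
  proof -
    have "\<iota> (sB c 1) * h = sH c h" for c h
      using iota_linear by (simp add: Vector_Spaces.linear_iff iota_one scale_mult_left)
    then have "\<phi> (\<iota> (\<zeta> (\<gamma> a * \<gamma> (\<pi> c))) * h) = \<epsilon>H c * (\<epsilon>C a * \<phi> h)" for a c h
      using assms(2) by (simp add: mult_split_def form_scale(1)[OF \<phi>] pi_counit algebra_simps)
    then show ?thesis by simp
  qed
  also have "\<dots> = \<Delta>C x (\<lambda>a b. \<epsilon>C a * \<phi> (\<gamma> (act b (\<gamma> y))))"
  proof -
    have "\<Delta>H (\<gamma> y) (\<lambda>c d. \<epsilon>H c * (\<epsilon>C a * \<phi> (\<gamma> (act b d)))) = \<epsilon>C a * \<phi> (\<gamma> (act b (\<gamma> y)))" for a b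
      by (rule counit_form) (intro intros)
    then show ?thesis by simp
  qed
  also have "\<dots> = \<phi> (\<gamma> (act x (\<gamma> y)))"
    by (rule C.counit_form) (intro intros)
  also have "act x (\<gamma> y) = \<pi> (\<gamma> x * \<gamma> y)"
    by (simp add: pi_module_map pi_gamma)
  finally show "\<phi> (\<gamma> x * \<gamma> y) = \<phi> (\<gamma> (\<pi> (\<gamma> x * \<gamma> y)))" .
qed

text \<open>
  It suffices to take $h = \iota(b)\gamma(x)$, where left $B$-linearity of \<open>\<zeta>\<close> reduces the claim
  to \<open>mult_split\<close>.
\<close>

lemma zeta_mult_gamma:
  assumes "mult_split"
  shows "\<zeta> (h * \<gamma> y) = sB (\<epsilon>C y) (\<zeta> h)"
proof (rule form_eqI)
  fix \<psi> assume \<psi>: "lin sB (*) \<psi>"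
  note intros = lin_intros lin_compose[OF \<psi>]
  have "\<psi> (\<zeta> (h * \<gamma> y)) = \<Delta>H h (\<lambda>a b. \<psi> (\<zeta> (\<iota> (\<zeta> a) * \<gamma> (\<pi> b) * \<gamma> y)))"
    by (rule decomposition_form[symmetric]) (intro intros)
  also have "\<dots> = \<Delta>H h (\<lambda>a b. \<epsilon>C y * \<psi> (\<zeta> (\<iota> (\<zeta> a) * \<gamma> (\<pi> b))))"
    using assms by (simp add: mult_split_def mult.assoc zeta_module_map zeta_gamma_counit
        B.scale_mult_right form_scale(2)[OF \<psi>] algebra_simps)
  also have "\<dots> = \<epsilon>C y * \<psi> (\<zeta> h)"
    by (rule decomposition_form) (intro intros)
  finally show "\<psi> (\<zeta> (h * \<gamma> y)) = \<psi> (sB (\<epsilon>C y) (\<zeta> h))"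
    by (simp add: form_scale(2)[OF \<psi>])
qed

text \<open>
  In other words $\ker\zeta$ is a left ideal: $k$ and $\iota(\zeta(k))$ differ by an element of it.
\<close>

lemma zeta_mult_right:
  assumes "mult_split"
  shows "\<zeta> (h * k) = \<zeta> (h * \<iota> (\<zeta> k))"
proof (rule form_eqI)
  fix \<psi> assume \<psi>: "lin sB (*) \<psi>"
  note intros = lin_intros lin_compose[OF \<psi>]
  have "\<psi> (\<zeta> (h * k)) = \<Delta>H k (\<lambda>a b. \<psi> (\<zeta> (h * (\<iota> (\<zeta> a) * \<gamma> (\<pi> b)))))"
    by (rule decomposition_form[symmetric]) (intro intros)
  also have "\<dots> = \<Delta>H k (\<lambda>a b. \<psi> (\<zeta> (h * \<iota> (\<zeta> a))) * \<epsilon>H b)"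
    using zeta_mult_gamma[OF assms, of "h * \<iota> (\<zeta> _)"]
    by (simp add: mult.assoc[symmetric] form_scale(2)[OF \<psi>] pi_counit mult.commute)
  also have "\<dots> = \<psi> (\<zeta> (h * \<iota> (\<zeta> k)))"
    by (rule counit_form) (intro intros)
  finally show "\<psi> (\<zeta> (h * k)) = \<psi> (\<zeta> (h * \<iota> (\<zeta> k)))" .
qed

lemma associator_form:
  assumes P: comult_split and M: mult_split
    and \<beta>: "\<And>b. lin sB (*) (\<lambda>a. \<beta> a b)" "\<And>a. lin sB (*) (\<lambda>b. \<beta> a b)"
  shows "\<Delta>H (\<gamma> y) (\<lambda>a b. \<beta> (\<zeta> (\<gamma> x * a)) (\<zeta> b)) = \<epsilon>C x * \<epsilon>C y * \<beta> 1 1"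
proof -
  note intros = lin_intros lin_compose[OF \<beta>(1)] lin_compose[OF \<beta>(2)]
  have "\<Delta>H (\<gamma> y) (\<lambda>a b. \<beta> (\<zeta> (\<gamma> x * a)) (\<zeta> b)) = \<Delta>H (\<gamma> y) (\<lambda>a b. \<beta> (\<zeta> (\<gamma> x * \<gamma> (\<pi> a))) (\<zeta> b))"
    by (rule comult_gamma_left_in_range[OF P, symmetric]) (intro intros)+
  also have "\<dots> = \<Delta>H (\<gamma> y) (\<lambda>a b. \<epsilon>H a * (\<epsilon>C x * \<beta> 1 (\<zeta> b)))"
    using M by (simp add: mult_split_def form_scale(2)[OF \<beta>(1)] pi_counit algebra_simps)
  also have "\<dots> = \<epsilon>C x * \<beta> 1 (\<zeta> (\<gamma> y))"
    by (rule counit_form) (intro intros)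
  finally show ?thesis
    by (simp add: zeta_gamma_counit form_scale(2)[OF \<beta>(2)] algebra_simps)
qed

text \<open>
  The hypothesis is the triviality of the associator, read off from its coefficients. It specialises to
  \<open>comult_split\<close> at $x = \pi(1)$, where $\gamma(x) = 1$, and to \<open>mult_split\<close> for the form
  $\psi = \varepsilon\iota$, where $\psi\zeta = \varepsilon$.
\<close>

lemma split_if_associator_form:
  assumes *: "\<And>\<phi> \<psi> x y. lin sB (*) \<phi> \<Longrightarrow> lin sB (*) \<psi> \<Longrightarrow>
    \<Delta>H (\<gamma> y) (\<lambda>a b. \<phi> (\<zeta> (\<gamma> x * a)) * \<psi> (\<zeta> b)) = \<epsilon>C x * \<epsilon>C y * (\<phi> 1 * \<psi> 1)"
  shows "comult_split \<and> mult_split"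
proof
  show comult_split
    unfolding comult_split_def
  proof (intro allI impI)
    fix \<phi> \<psi> y assume "lin sB (*) \<phi>" "lin sB (*) \<psi>"
    then show "\<Delta>H (\<gamma> y) (\<lambda>a b. \<phi> (\<zeta> a) * \<psi> (\<zeta> b)) = \<epsilon>C y * (\<phi> 1 * \<psi> 1)"
      using *[of \<phi> \<psi> y "\<pi> 1"] by (simp add: gamma_one counit_pi_one)
  qed
  show mult_split
    unfolding mult_split_def
  proof (intro allI form_eqI)
    fix x y \<phi> assume \<phi>: "lin sB (*) \<phi>"
    have \<psi>: "lin sB (*) (\<lambda>b. \<epsilon>H (\<iota> b))" by (intro lin_intros)
    have "\<phi> (\<zeta> (\<gamma> x * \<gamma> y)) = \<Delta>H (\<gamma> y) (\<lambda>a b. \<phi> (\<zeta> (\<gamma> x * a)) * \<epsilon>H b)"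
      by (rule counit_form[symmetric]) (intro lin_intros lin_compose[OF \<phi>])
    also have "\<dots> = \<epsilon>C x * \<epsilon>C y * \<phi> 1"
      using *[OF \<phi> \<psi>, of y x] by (simp add: counit_zeta iota_one counit_one)
    finally show "\<phi> (\<zeta> (\<gamma> x * \<gamma> y)) = \<phi> (sB (\<epsilon>C x * \<epsilon>C y) 1)"
      by (simp add: form_scale(2)[OF \<phi>])
  qed
qed

end

section \<open>Tensors over finite-dimensional dual spaces\<close>

lemma linear_form_linear_combination:
  assumes "linear_form V \<phi>" "closed_vspace V" "\<And>i. i \<in> I \<Longrightarrow> v i \<in> carr V"
  shows "\<phi> (\<Sum>i\<in>I. scl V (c i) (v i)) = (\<Sum>i\<in>I. c i * \<phi> (v i))"
proof -
  have 0: "\<phi> 0 = 0"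
  proof -
    have "\<phi> (0 + 0) = \<phi> 0 + \<phi> 0"
      using assms(1,2) unfolding linear_form_def closed_vspace_def by blast
    then show ?thesis by (simp only: add_0_left add_cancel_right_right)
  qed
  have "\<phi> (\<Sum>i\<in>I. scl V (c i) (v i)) = (\<Sum>i\<in>I. c i * \<phi> (v i)) \<and> (\<Sum>i\<in>I. scl V (c i) (v i)) \<in> carr V"
    using assms
    by (induction I rule: infinite_finite_induct) (simp_all add: 0 linear_form_def closed_vspace_def)
  then show ?thesis ..
qed

lemma bilinear_form_evaluation:
  "bilinear_form (dual s) (dual t) (\<lambda>f g. f x * g y)"
  by (simp add: bilinear_form_def linear_form_def fscale_def algebra_simps)

lemma tensor_spanI:
  fixes x :: "'i \<Rightarrow> 'a::ab_group_add" and y :: "'i \<Rightarrow> 'b::ab_group_add"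
  assumes "\<And>i. i \<in> I \<Longrightarrow> x i \<in> X" "\<And>i. i \<in> I \<Longrightarrow> y i \<in> Y"
  shows "(\<lambda>\<beta>. \<Sum>i\<in>I. c i * tensor V W (x i) (y i) \<beta>) \<in> tensor_span V W X Y"
proof -
  have "(\<lambda>\<beta>. \<Sum>i\<in>I. c i * tensor V W (x i) (y i) \<beta>) = (\<Sum>i\<in>I. fscale (c i) (tensor V W (x i) (y i)))"
    by (simp add: fun_eq_iff sum_fun_apply fscale_def)
  also have "\<dots> \<in> tensor_span V W X Y"
    unfolding tensor_span_def using assms
    by (intro fscale.span_sum fscale.span_scale fscale.span_base) blast
  finally show ?thesis .
qed

lemma tensor_span_mono:
  "X \<subseteq> X' \<Longrightarrow> Y \<subseteq> Y' \<Longrightarrow> tensor_span V W X Y \<subseteq> tensor_span V W X' Y'"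
  unfolding tensor_span_def by (intro fscale.span_mono) blast

text \<open>
  A form on the dual is only constrained on linear functions, so the expansion is valid for linear
  \<open>f\<close> only.
\<close>

lemma linear_form_dual_basis:
  assumes E: "finite_dimensional_vector_space sX E"
    and \<phi>: "linear_form (dual sX) \<phi>" and f: "lin sX (*) f"
  shows "\<phi> f = (\<Sum>e\<in>E. f e * \<phi> (\<lambda>x. module.representation sX E x e))"
proof -
  interpret X: finite_dimensional_vector_space sX E by (rule E)
  have "f = (\<Sum>e\<in>E. fscale (f e) (\<lambda>x. X.representation E x e))"
  proof
    fix x
    show "f x = (\<Sum>e\<in>E. fscale (f e) (\<lambda>x. X.representation E x e)) x"
      by (subst form_coordinates[OF E f, of x]) (simp add: sum_fun_apply fscale_def mult.commute)
  qed
  then have "\<phi> f = \<phi> (\<Sum>e\<in>E. fscale (f e) (\<lambda>x. X.representation E x e))" by simp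
  also have "\<dots> = (\<Sum>e\<in>E. f e * \<phi> (\<lambda>x. X.representation E x e))"
    using linear_form_linear_combination[OF \<phi>, of E "\<lambda>e x. X.representation E x e" f]
    by (simp add: X.vector_space_axioms lin_coordinate[OF E X.linear_ident])
  finally show ?thesis .
qed

context
  fixes sX :: "'k::field \<Rightarrow> 'x::ab_group_add \<Rightarrow> 'x" and E
    and sY :: "'k \<Rightarrow> 'y::ab_group_add \<Rightarrow> 'y" and E'
  assumes E: "finite_dimensional_vector_space sX E" and E': "finite_dimensional_vector_space sY E'"
begin

interpretation X: finite_dimensional_vector_space sX E by (rule E)
interpretation Y: finite_dimensional_vector_space sY E' by (rule E')

text \<open>
  In finite dimension, a tensor of functionals is determined by its values at pairs of points: both
  arguments of the bilinear form are expanded in the dual bases.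
\<close>

lemma dual_tensor_expansion:
  assumes t: "t \<in> carr (tensor_space (dual sX) (dual sY))" and \<beta>: "bilinear_form (dual sX) (dual sY) \<beta>"
  shows "t \<beta> = (\<Sum>e\<in>E. \<Sum>e'\<in>E'. t (\<lambda>f g. f e * g e') *
     \<beta> (\<lambda>x. X.representation E x e) (\<lambda>y. Y.representation E' y e'))"
proof -
  have cl: "closed_vspace (dual sX)" "closed_vspace (dual sY)"
    by (simp_all add: X.vector_space_axioms Y.vector_space_axioms)
  have bil: "bilinear_form (dual sX) (dual sY) (\<lambda>f g. b * (f e * g e'))" for b e e'
    by (simp add: bilinear_form_def linear_form_def fscale_def algebra_simps)
  have sum_bil: "bilinear_form (dual sX) (dual sY) (\<lambda>f g. \<Sum>e'\<in>E'. b e' * (f e * g e'))" for b e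
    using bil by (auto simp: bilinear_form_def intro!: linear_form_sum)
  have "t \<beta> = t (\<lambda>f g. \<Sum>e\<in>E. \<Sum>e'\<in>E'.
     \<beta> (\<lambda>x. X.representation E x e) (\<lambda>y. Y.representation E' y e') * (f e * g e'))"
  proof (rule tensor_cong[OF t cl])
    fix f g assume f: "f \<in> carr (dual sX)" and g: "g \<in> carr (dual sY)"
    have "\<beta> f g = (\<Sum>e\<in>E. f e * \<beta> (\<lambda>x. X.representation E x e) g)"
      using \<beta> f g by (intro linear_form_dual_basis[OF E]) (simp_all add: bilinear_form_def)
    also have "\<dots> = (\<Sum>e\<in>E. f e * (\<Sum>e'\<in>E'. g e' *
        \<beta> (\<lambda>x. X.representation E x e) (\<lambda>y. Y.representation E' y e')))"
    proof (intro sum.cong refl arg_cong2[where f = "(*)"])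
      fix e
      show "\<beta> (\<lambda>x. X.representation E x e) g = (\<Sum>e'\<in>E'. g e' *
        \<beta> (\<lambda>x. X.representation E x e) (\<lambda>y. Y.representation E' y e'))"
        using \<beta> g
        by (intro linear_form_dual_basis[OF E']) (simp_all add: bilinear_form_def lin_coordinate[OF E X.linear_ident])
    qed
    finally show "\<beta> f g = (\<Sum>e\<in>E. \<Sum>e'\<in>E'.
        \<beta> (\<lambda>x. X.representation E x e) (\<lambda>y. Y.representation E' y e') * (f e * g e'))"
      by (simp add: sum_distrib_left algebra_simps)
  qed
  also have "\<dots> = (\<Sum>e\<in>E. \<Sum>e'\<in>E'. t (\<lambda>f g.
     \<beta> (\<lambda>x. X.representation E x e) (\<lambda>y. Y.representation E' y e') * (f e * g e')))"
    by (subst tensor_sum[OF t sum_bil]) (intro sum.cong refl tensor_sum[OF t bil])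
  also have "\<dots> = (\<Sum>e\<in>E. \<Sum>e'\<in>E'. t (\<lambda>f g. f e * g e') *
     \<beta> (\<lambda>x. X.representation E x e) (\<lambda>y. Y.representation E' y e'))"
    by (simp only: tensor_scale[OF t bilinear_form_evaluation]) (simp only: mult.commute)
  finally show ?thesis .
qed

lemma dual_tensor_eqI:
  assumes t: "t \<in> carr (tensor_space (dual sX) (dual sY))" "t' \<in> carr (tensor_space (dual sX) (dual sY))"
    and eq: "\<And>x y. t (\<lambda>f g. f x * g y) = t' (\<lambda>f g. f x * g y)"
  shows "t = t'"
proof
  fix \<beta>
  show "t \<beta> = t' \<beta>"
  proof (cases "bilinear_form (dual sX) (dual sY) \<beta>")
    case True
    show ?thesis
      unfolding dual_tensor_expansion[OF t(1) True] dual_tensor_expansion[OF t(2) True] by (simp add: eq)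
  next
    case False
    then show ?thesis using t by (simp add: tensor_not_bilinear)
  qed
qed

context
  fixes m :: "'x \<Rightarrow> 'y \<Rightarrow> 'x" and f
  assumes m: "\<And>y. lin sX sX (\<lambda>x. m x y)" "\<And>x. lin sY sX (\<lambda>y. m x y)" and f: "lin sX (*) f"
begin

text \<open>
  This resolves the definite description in \<open>dual_coaction\<close>. Existence is witnessed by
  $\sum_e e^* \otimes f(m(e,-))$ with $e$ running over a basis of $X$, uniqueness is \<open>dual_tensor_eqI\<close>.
\<close>

lemma dual_coaction:
  shows dual_coaction_mem: "dual_coaction sX sY m f \<in> carr (tensor_space (dual sX) (dual sY))"
    and dual_coaction_evaluation: "dual_coaction sX sY m f (\<lambda>f1 f2. f1 x * f2 y) = f (m x y)"
proof -
  define t where "t = (\<lambda>\<beta>. \<Sum>e\<in>E. 1 * tensor (dual sX) (dual sY)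
      (\<lambda>x. X.representation E x e) (\<lambda>y. f (m e y)) \<beta>)"
  have "t \<in> tensor_span (dual sX) (dual sY) (carr (dual sX)) (carr (dual sY))"
    unfolding t_def
    by (intro tensor_spanI) (simp_all add: lin_coordinate[OF E X.linear_ident] lin_compose[OF f m(2)])
  then have mem: "t \<in> carr (tensor_space (dual sX) (dual sY))"
    by (simp add: tensor_space_def)
  have "(\<Sum>e\<in>E. X.representation E x e * f (m e y)) = f (m x y)" for x y
    by (rule form_coordinates[OF E lin_compose[OF f m(1)], symmetric])
  then have eval: "t (\<lambda>f1 f2. f1 x * f2 y) = f (m x y)" for x y
    by (simp add: t_def tensor_def bilinear_form_evaluation)
  have "dual_coaction sX sY m f = t"
    unfolding dual_coaction_def
  proof (rule the_equality)
    show "t \<in> carr (tensor_space (dual sX) (dual sY)) \<and> (\<forall>x y. t (\<lambda>f1 f2. f1 x * f2 y) = f (m x y))"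
      using mem eval by blast
    show "t' = t" if "t' \<in> carr (tensor_space (dual sX) (dual sY)) \<and>
        (\<forall>x y. t' (\<lambda>f1 f2. f1 x * f2 y) = f (m x y))" for t'
      by (rule dual_tensor_eqI) (use that mem eval in simp_all)
  qed
  then show "dual_coaction sX sY m f \<in> carr (tensor_space (dual sX) (dual sY))"
    "dual_coaction sX sY m f (\<lambda>f1 f2. f1 x * f2 y) = f (m x y)"
    using mem eval by auto
qed

lemma dual_coaction_eqI:
  assumes "t \<in> carr (tensor_space (dual sX) (dual sY))" "\<And>x y. t (\<lambda>f1 f2. f1 x * f2 y) = f (m x y)"
  shows "dual_coaction sX sY m f = t"
  by (rule dual_tensor_eqI) (simp_all add: assms dual_coaction)

lemma dual_coaction_form:
  assumes "bilinear_form (dual sX) (dual sY) \<beta>"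
  shows "dual_coaction sX sY m f \<beta> = (\<Sum>e\<in>E. \<Sum>e'\<in>E'. f (m e e') *
     \<beta> (\<lambda>x. X.representation E x e) (\<lambda>y. Y.representation E' y e'))"
  by (simp add: dual_tensor_expansion[OF dual_coaction_mem assms] dual_coaction_evaluation)

end

end

section \<open>Coideal subalgebras\<close>

context partially_admissible_mapping_system
begin

text \<open>
  From left to right, \<open>\<zeta>\<close> restricted to $\gamma(C)$ is the counit, and both equations follow by
  applying \<open>\<zeta>\<close> to elements of $\gamma(C)$. The converse is \<open>comult_gamma_left_in_range\<close> together with
  \<open>gamma_mult_in_range\<close>.
\<close>

lemma right_coideal_subalgebra_iff:
  "right_coideal_subalgebra (whole sH) (*) 1 \<Delta>H (range \<gamma>) \<longleftrightarrow> comult_split \<and> mult_split"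
proof
  assume *: "right_coideal_subalgebra (whole sH) (*) 1 \<Delta>H (range \<gamma>)"
  have comult_split
    unfolding comult_split_def
  proof (intro allI impI)
    fix \<phi> \<psi> y assume \<phi>: "lin sB (*) \<phi>" and \<psi>: "lin sB (*) \<psi>"
    note intros = lin_intros lin_compose[OF \<phi>] lin_compose[OF \<psi>]
    have "\<Delta>H (\<gamma> y) \<in> tensor_span (whole sH) (whole sH) (range \<gamma>) UNIV"
      using * by (simp add: right_coideal_subalgebra_def)
    then obtain n :: nat and c u v
      where u: "\<And>i. i < n \<Longrightarrow> u i \<in> range \<gamma>" and "\<And>i. i < n \<Longrightarrow> v i \<in> UNIV"
      and exp: "\<And>\<beta>. bilinear_form (whole sH) (whole sH) \<beta> \<Longrightarrow> \<Delta>H (\<gamma> y) \<beta> = (\<Sum>i<n. c i * \<beta> (u i) (v i))"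
      and "\<And>\<beta>. \<not> bilinear_form (whole sH) (whole sH) \<beta> \<Longrightarrow> \<Delta>H (\<gamma> y) \<beta> = 0"
      by (rule tensor_span_expansion) (rule that)
    have "\<phi> (\<zeta> (u i)) = \<epsilon>H (u i) * \<phi> 1" if "i < n" for i
      using u[OF that] by (auto simp: zeta_gamma_counit counit_gamma form_scale(2)[OF \<phi>])
    then have "(\<Sum>i<n. c i * (\<phi> (\<zeta> (u i)) * \<psi> (\<zeta> (v i)))) =
        (\<Sum>i<n. c i * (\<epsilon>H (u i) * (\<phi> 1 * \<psi> (\<zeta> (v i)))))"
      by (simp add: mult.assoc)
    moreover have "bilinear_form (whole sH) (whole sH) (\<lambda>a b. \<phi> (\<zeta> a) * \<psi> (\<zeta> b))"
      "bilinear_form (whole sH) (whole sH) (\<lambda>a b. \<epsilon>H a * (\<phi> 1 * \<psi> (\<zeta> b)))"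
      by (intro bilinear_form_wholeI intros)+
    ultimately have "\<Delta>H (\<gamma> y) (\<lambda>a b. \<phi> (\<zeta> a) * \<psi> (\<zeta> b)) = \<Delta>H (\<gamma> y) (\<lambda>a b. \<epsilon>H a * (\<phi> 1 * \<psi> (\<zeta> b)))"
      by (simp add: exp)
    also have "\<dots> = \<phi> 1 * \<psi> (\<zeta> (\<gamma> y))"
      by (rule counit_form) (intro intros)
    finally show "\<Delta>H (\<gamma> y) (\<lambda>a b. \<phi> (\<zeta> a) * \<psi> (\<zeta> b)) = \<epsilon>C y * (\<phi> 1 * \<psi> 1)"
      by (simp add: zeta_gamma_counit form_scale(2)[OF \<psi>] algebra_simps)
  qed
  moreover have mult_split
    unfolding mult_split_def
  proof (intro allI)
    fix x y
    have "\<gamma> x * \<gamma> y \<in> range \<gamma>"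
      using * by (simp add: right_coideal_subalgebra_def is_subalgebra_def)
    then obtain z where z: "\<gamma> x * \<gamma> y = \<gamma> z" by blast
    then have "\<epsilon>C z = \<epsilon>C x * \<epsilon>C y"
      by (metis counit_gamma counit_mult)
    then show "\<zeta> (\<gamma> x * \<gamma> y) = sB (\<epsilon>C x * \<epsilon>C y) 1"
      by (simp add: z zeta_gamma_counit)
  qed
  ultimately show "comult_split \<and> mult_split" ..
next
  assume "comult_split \<and> mult_split"
  then have P: comult_split and M: mult_split by auto
  interpret \<gamma>: Vector_Spaces.linear sC sH \<gamma> by (rule gamma_linear)
  have "subspace (range \<gamma>)"
    by (intro \<gamma>.subspace_image C.subspace_UNIV)
  moreover have "\<gamma> x * \<gamma> y \<in> range \<gamma>" for x y
    by (subst gamma_mult_in_range[OF P M]) blast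
  moreover have "1 \<in> range \<gamma>"
    using gamma_one by (metis rangeI)
  moreover have "\<Delta>H (\<gamma> y) \<in> tensor_span (whole sH) (whole sH) (range \<gamma>) UNIV" for y
  proof -
    obtain n :: nat and c u v
      where "\<And>i. i < n \<Longrightarrow> u i \<in> carr (whole sH)" "\<And>i. i < n \<Longrightarrow> v i \<in> carr (whole sH)"
      and exp: "\<And>\<beta>. bilinear_form (whole sH) (whole sH) \<beta> \<Longrightarrow> \<Delta>H (\<gamma> y) \<beta> = (\<Sum>i<n. c i * \<beta> (u i) (v i))"
      "\<And>\<beta>. \<not> bilinear_form (whole sH) (whole sH) \<beta> \<Longrightarrow> \<Delta>H (\<gamma> y) \<beta> = 0"
      by (rule tensor_expansion[OF comult_closed]) (rule that)
    have "\<Delta>H (\<gamma> y) \<beta> = (\<Sum>i<n. c i * tensor (whole sH) (whole sH) (\<gamma> (\<pi> (u i))) (v i) \<beta>)" for \<beta>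
    proof (cases "bilinear_form (whole sH) (whole sH) \<beta>")
      case True
      then have \<beta>: "lin sH (*) (\<lambda>a. \<beta> a b)" "lin sH (*) (\<lambda>b. \<beta> a b)" for a b
        by (simp_all add: bilinear_form_def linear_form_whole vector_spaces)
      have "\<Delta>H (\<gamma> y) \<beta> = \<Delta>H (\<gamma> y) (\<lambda>a b. \<beta> (\<gamma> (\<pi> a)) b)"
        by (rule comult_gamma_left_in_range[OF P \<beta>, symmetric])
      also have "\<dots> = (\<Sum>i<n. c i * \<beta> (\<gamma> (\<pi> (u i))) (v i))"
        by (intro exp bilinear_form_wholeI lin_intros lin_compose[OF \<beta>(1)] \<beta>(2))
      finally show ?thesis using True by (simp add: tensor_def)
    next
      case False
      then show ?thesis by (simp add: exp tensor_def)
    qed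
    then have "\<Delta>H (\<gamma> y) = (\<lambda>\<beta>. \<Sum>i<n. c i * tensor (whole sH) (whole sH) (\<gamma> (\<pi> (u i))) (v i) \<beta>)"
      by (simp add: fun_eq_iff)
    also have "\<dots> \<in> tensor_span (whole sH) (whole sH) (range \<gamma>) UNIV"
      by (rule tensor_spanI) auto
    finally show ?thesis .
  qed
  ultimately show "right_coideal_subalgebra (whole sH) (*) 1 \<Delta>H (range \<gamma>)"
    by (auto simp: right_coideal_subalgebra_def is_subalgebra_def)
qed

text \<open>
  The product of $\varphi\zeta$ and $\psi\zeta$ in $H^*$ depends on $\zeta(h)$ only, hence lies in
  $\zeta^*(B^*)$. For $h = k\gamma(y)$ the first factor of $\Delta(\gamma(y))$ is moved into $\gamma(C)$, and then
  both factors are absorbed as scalars, leaving $\varepsilon(y)$ times the value at $k$.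
\<close>

lemma dual_mult_split:
  assumes P: comult_split and M: mult_split and \<phi>: "lin sB (*) \<phi>" and \<psi>: "lin sB (*) \<psi>"
  shows "\<Delta>H h (\<lambda>a b. \<phi> (\<zeta> a) * \<psi> (\<zeta> b)) = \<Delta>H (\<iota> (\<zeta> h)) (\<lambda>a b. \<phi> (\<zeta> a) * \<psi> (\<zeta> b))"
proof -
  note intros = lin_intros lin_compose[OF \<phi>] lin_compose[OF \<psi>]
  have gamma: "\<Delta>H (k * \<gamma> y) (\<lambda>a b. \<phi> (\<zeta> a) * \<psi> (\<zeta> b)) = \<epsilon>C y * \<Delta>H k (\<lambda>a b. \<phi> (\<zeta> a) * \<psi> (\<zeta> b))" for k y
  proof -
    have "\<Delta>H (k * \<gamma> y) (\<lambda>a b. \<phi> (\<zeta> a) * \<psi> (\<zeta> b)) =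
        \<Delta>H k (\<lambda>a b. \<Delta>H (\<gamma> y) (\<lambda>c d. \<phi> (\<zeta> (a * c)) * \<psi> (\<zeta> (b * d))))"
      by (rule comult_mult_form) (intro intros)+
    also have "\<dots> = \<Delta>H k (\<lambda>a b. \<Delta>H (\<gamma> y) (\<lambda>c d. \<phi> (\<zeta> (a * \<gamma> (\<pi> c))) * \<psi> (\<zeta> (b * d))))"
    proof -
      have "\<Delta>H (\<gamma> y) (\<lambda>c d. \<phi> (\<zeta> (a * \<gamma> (\<pi> c))) * \<psi> (\<zeta> (b * d))) =
          \<Delta>H (\<gamma> y) (\<lambda>c d. \<phi> (\<zeta> (a * c)) * \<psi> (\<zeta> (b * d)))" for a b
        by (rule comult_gamma_left_in_range[OF P]) (intro intros)+
      then show ?thesis by simp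
    qed
    also have "\<dots> = \<Delta>H k (\<lambda>a b. \<Delta>H (\<gamma> y) (\<lambda>c d. \<epsilon>H c * (\<phi> (\<zeta> a) * \<psi> (\<zeta> (b * d)))))"
      by (simp add: zeta_mult_gamma[OF M] pi_counit form_scale(2)[OF \<phi>] mult.assoc)
    also have "\<dots> = \<Delta>H k (\<lambda>a b. \<phi> (\<zeta> a) * \<psi> (\<zeta> (b * \<gamma> y)))"
    proof -
      have "\<Delta>H (\<gamma> y) (\<lambda>c d. \<epsilon>H c * (\<phi> (\<zeta> a) * \<psi> (\<zeta> (b * d)))) = \<phi> (\<zeta> a) * \<psi> (\<zeta> (b * \<gamma> y))" for a b
        by (rule counit_form) (intro intros)
      then show ?thesis by simp
    qed
    also have "\<dots> = \<Delta>H k (\<lambda>a b. \<epsilon>C y * (\<phi> (\<zeta> a) * \<psi> (\<zeta> b)))"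
      by (simp add: zeta_mult_gamma[OF M] form_scale(2)[OF \<psi>] mult.left_commute)
    also have "\<dots> = \<epsilon>C y * \<Delta>H k (\<lambda>a b. \<phi> (\<zeta> a) * \<psi> (\<zeta> b))"
      by (rule comult_scale) (intro intros)+
    finally show ?thesis .
  qed
  have "\<Delta>H h (\<lambda>a b. \<phi> (\<zeta> a) * \<psi> (\<zeta> b)) =
      \<Delta>H h (\<lambda>c d. \<Delta>H (\<iota> (\<zeta> c) * \<gamma> (\<pi> d)) (\<lambda>a b. \<phi> (\<zeta> a) * \<psi> (\<zeta> b)))"
    by (rule decomposition_form[symmetric]) (intro intros)
  also have "\<dots> = \<Delta>H h (\<lambda>c d. \<Delta>H (\<iota> (\<zeta> c)) (\<lambda>a b. \<phi> (\<zeta> a) * \<psi> (\<zeta> b)) * \<epsilon>H d)"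
    by (simp add: gamma pi_counit mult.commute)
  also have "\<dots> = \<Delta>H (\<iota> (\<zeta> h)) (\<lambda>a b. \<phi> (\<zeta> a) * \<psi> (\<zeta> b))"
    by (rule counit_form) (intro intros)
  finally show ?thesis .
qed

text \<open>
  The elements of $\zeta^*(B^*)$ cannot tell $\gamma(y)$ from $\varepsilon(y)1$, because \<open>\<zeta>\<close> cannot. Evaluating
  a product of two such elements at $\gamma(y)$ gives \<open>comult_split\<close>, evaluating the coproduct of one at
  $(\gamma(x), \gamma(y))$ gives \<open>mult_split\<close>.
\<close>

lemma left_coideal_subalgebra_iff:
  "left_coideal_subalgebra (dual sH) (dual_mult \<Delta>H) \<epsilon>H (dual_comult sH) (transpose_map \<zeta> ` carr (dual sB))
     \<longleftrightarrow> comult_split \<and> mult_split"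
proof -
  define A where "A = transpose_map \<zeta> ` carr (dual sB)"
  have A: "f \<in> A \<longleftrightarrow> (\<exists>\<phi>. lin sB (*) \<phi> \<and> f = (\<lambda>h. \<phi> (\<zeta> h)))" for f
    by (auto simp: A_def transpose_map_def fun_eq_iff)
  obtain E where E: "finite_dimensional_vector_space sH E" using finite_dimensional by blast
  have mult_lin: "lin sH sH (\<lambda>x. x * y)" "lin sH sH (\<lambda>y. x * y)" for x y
    by (intro lin_intros)+
  note dual_comult_evaluation = dual_coaction_evaluation[OF E E mult_lin, folded dual_comult_def]
  note dual_comult_eqI = dual_coaction_eqI[OF E E mult_lin, folded dual_comult_def]
  have "left_coideal_subalgebra (dual sH) (dual_mult \<Delta>H) \<epsilon>H (dual_comult sH) A \<longleftrightarrow> comult_split \<and> mult_split"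
  proof
    assume *: "left_coideal_subalgebra (dual sH) (dual_mult \<Delta>H) \<epsilon>H (dual_comult sH) A"
    have comult_split
      unfolding comult_split_def
    proof (intro allI impI)
      fix \<phi> \<psi> y assume \<phi>: "lin sB (*) \<phi>" and \<psi>: "lin sB (*) \<psi>"
      note intros = lin_intros lin_compose[OF \<phi>] lin_compose[OF \<psi>]
      have "dual_mult \<Delta>H (\<lambda>h. \<phi> (\<zeta> h)) (\<lambda>h. \<psi> (\<zeta> h)) \<in> A"
        using * \<phi> \<psi> A unfolding left_coideal_subalgebra_def is_subalgebra_def by blast
      then obtain \<theta> where \<theta>: "lin sB (*) \<theta>"
        and "dual_mult \<Delta>H (\<lambda>h. \<phi> (\<zeta> h)) (\<lambda>h. \<psi> (\<zeta> h)) = (\<lambda>h. \<theta> (\<zeta> h))"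
        using A by blast
      then have eq: "\<Delta>H h (\<lambda>a b. \<phi> (\<zeta> a) * \<psi> (\<zeta> b)) = \<theta> (\<zeta> h)" for h
        by (simp add: dual_mult_def fun_eq_iff)
      have "\<Delta>H 1 (\<lambda>a b. \<phi> (\<zeta> a) * \<psi> (\<zeta> b)) = \<phi> (\<zeta> 1) * \<psi> (\<zeta> 1)"
        by (rule comult_one_form) (intro intros)+
      then show "\<Delta>H (\<gamma> y) (\<lambda>a b. \<phi> (\<zeta> a) * \<psi> (\<zeta> b)) = \<epsilon>C y * (\<phi> 1 * \<psi> 1)"
        by (simp add: eq zeta_one zeta_gamma_counit form_scale(2)[OF \<theta>])
    qed
    moreover have mult_split
      unfolding mult_split_def
    proof (intro allI form_eqI)
      fix x y \<phi> assume \<phi>: "lin sB (*) \<phi>"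
      have f: "lin sH (*) (\<lambda>h. \<phi> (\<zeta> h))" by (intro lin_intros lin_compose[OF \<phi>])
      have "dual_comult sH (\<lambda>h. \<phi> (\<zeta> h)) \<in> tensor_span (dual sH) (dual sH) (carr (dual sH)) A"
        using * \<phi> A unfolding left_coideal_subalgebra_def by blast
      then obtain n :: nat and c p q
        where "\<And>i. i < n \<Longrightarrow> p i \<in> carr (dual sH)" and q: "\<And>i. i < n \<Longrightarrow> q i \<in> A"
        and exp: "\<And>\<beta>. bilinear_form (dual sH) (dual sH) \<beta> \<Longrightarrow>
          dual_comult sH (\<lambda>h. \<phi> (\<zeta> h)) \<beta> = (\<Sum>i<n. c i * \<beta> (p i) (q i))"
        and "\<And>\<beta>. \<not> bilinear_form (dual sH) (dual sH) \<beta> \<Longrightarrow> dual_comult sH (\<lambda>h. \<phi> (\<zeta> h)) \<beta> = 0"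
        by (rule tensor_span_expansion) (rule that)
      have "q i (\<gamma> y) = \<epsilon>C y * q i 1" if i: "i < n" for i
      proof -
        obtain \<theta> where \<theta>: "lin sB (*) \<theta>" "q i = (\<lambda>h. \<theta> (\<zeta> h))" using q[OF i] A by blast
        show ?thesis by (simp add: \<theta>(2) zeta_gamma_counit zeta_one form_scale(2)[OF \<theta>(1)])
      qed
      then have "(\<Sum>i<n. c i * (p i (\<gamma> x) * q i (\<gamma> y))) = \<epsilon>C y * (\<Sum>i<n. c i * (p i (\<gamma> x) * q i 1))"
        by (simp add: sum_distrib_left algebra_simps)
      then have "dual_comult sH (\<lambda>h. \<phi> (\<zeta> h)) (\<lambda>f1 f2. f1 (\<gamma> x) * f2 (\<gamma> y)) =
          \<epsilon>C y * dual_comult sH (\<lambda>h. \<phi> (\<zeta> h)) (\<lambda>f1 f2. f1 (\<gamma> x) * f2 1)"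
        by (simp add: exp[OF bilinear_form_evaluation])
      then show "\<phi> (\<zeta> (\<gamma> x * \<gamma> y)) = \<phi> (sB (\<epsilon>C x * \<epsilon>C y) 1)"
        by (simp add: dual_comult_evaluation[OF f] zeta_gamma_counit form_scale(2)[OF \<phi>])
    qed
    ultimately show "comult_split \<and> mult_split" ..
  next
    assume "comult_split \<and> mult_split"
    then have P: comult_split and M: mult_split by auto
    have "A \<subseteq> carr (dual sH)"
    proof
      fix f assume "f \<in> A"
      then obtain \<phi> where \<phi>: "lin sB (*) \<phi>" "f = (\<lambda>h. \<phi> (\<zeta> h))" using A by blast
      show "f \<in> carr (dual sH)" by (simp add: \<phi>(2) lin_compose[OF \<phi>(1) zeta_linear])
    qed
    moreover have "fscale.subspace A"
    proof (rule fscale.subspaceI)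
      show "0 \<in> A" unfolding A
        by (intro exI[of _ "\<lambda>_. 0"]) (simp add: linear_scalar_iff vector_spaces fun_eq_iff)
      show "f + g \<in> A" if f: "f \<in> A" and g: "g \<in> A" for f g
      proof -
        obtain \<phi> \<psi> where "lin sB (*) \<phi>" "f = (\<lambda>h. \<phi> (\<zeta> h))" "lin sB (*) \<psi>" "g = (\<lambda>h. \<psi> (\<zeta> h))"
          using f g A by blast
        then show ?thesis unfolding A
          by (intro exI[of _ "\<lambda>b. \<phi> b + \<psi> b"]) (simp add: linear_scalar_iff vector_spaces fun_eq_iff algebra_simps)
      qed
      show "fscale c f \<in> A" if f: "f \<in> A" for c f
      proof -
        obtain \<phi> where "lin sB (*) \<phi>" "f = (\<lambda>h. \<phi> (\<zeta> h))" using f A by blast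
        then show ?thesis unfolding A
          by (intro exI[of _ "\<lambda>b. c * \<phi> b"]) (simp add: lin_scalar_mult fscale_def)
      qed
    qed
    moreover have "\<epsilon>H \<in> A"
      unfolding A by (intro exI[of _ "\<lambda>b. \<epsilon>H (\<iota> b)"] conjI lin_intros) (simp add: fun_eq_iff counit_zeta)
    moreover have "dual_mult \<Delta>H f g \<in> A" if f: "f \<in> A" and g: "g \<in> A" for f g
    proof -
      obtain \<phi> \<psi> where \<phi>: "lin sB (*) \<phi>" "f = (\<lambda>h. \<phi> (\<zeta> h))" and \<psi>: "lin sB (*) \<psi>" "g = (\<lambda>h. \<psi> (\<zeta> h))"
        using f g A by blast
      show ?thesis unfolding A
        by (intro exI[of _ "\<lambda>b. \<Delta>H (\<iota> b) (\<lambda>a b. \<phi> (\<zeta> a) * \<psi> (\<zeta> b))"] conjI lin_intros)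
          (simp only: fun_eq_iff dual_mult_def \<phi>(2) \<psi>(2), intro allI dual_mult_split[OF P M \<phi>(1) \<psi>(1)])
    qed
    moreover have "dual_comult sH f \<in> tensor_span (dual sH) (dual sH) (carr (dual sH)) A" if f: "f \<in> A" for f
    proof -
      obtain \<phi> where \<phi>: "lin sB (*) \<phi>" "f = (\<lambda>h. \<phi> (\<zeta> h))" using f A by blast
      have lin_f: "lin sH (*) f" unfolding \<phi>(2) by (intro lin_intros lin_compose[OF \<phi>(1)])
      define r where "r e h = module.representation sH E h e" for e h
      have r: "lin sH (*) (\<lambda>h. r e h)" for e
        unfolding r_def by (intro lin_coordinate[OF E] lin_intros)
      define q where "q e h = \<phi> (\<zeta> (e * \<iota> (\<zeta> h)))" for e h
      have q: "q e \<in> A" for e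
        unfolding A q_def[abs_def]
        by (intro exI[of _ "\<lambda>b. \<phi> (\<zeta> (e * \<iota> b))"] conjI lin_intros lin_compose[OF \<phi>(1)] refl)
      \<comment> \<open>By \<open>zeta_mult_right\<close>, $f(xy) = f(x\,\iota(\zeta(y)))$ depends on \<open>y\<close> only through $\zeta(y)$,
        so expanding \<open>x\<close> in a basis puts the second tensor factors into \<open>A\<close>.\<close>
      define t where "t = (\<lambda>\<beta>. \<Sum>e\<in>E. 1 * tensor (dual sH) (dual sH) (r e) (q e) \<beta>)"
      have t: "t \<in> tensor_span (dual sH) (dual sH) (carr (dual sH)) A"
        unfolding t_def by (intro tensor_spanI) (simp_all add: r q)
      have "t (\<lambda>f1 f2. f1 x * f2 y) = f (x * y)" for x y
      proof -
        have "f (x * y) = \<phi> (\<zeta> (x * \<iota> (\<zeta> y)))" by (simp add: \<phi>(2) zeta_mult_right[OF M, of x y])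
        also have "\<dots> = (\<Sum>e\<in>E. r e x * \<phi> (\<zeta> (e * \<iota> (\<zeta> y))))"
          unfolding r_def by (rule form_coordinates[OF E]) (intro lin_intros lin_compose[OF \<phi>(1)])
        finally show ?thesis by (simp add: t_def tensor_def bilinear_form_evaluation q_def)
      qed
      moreover have "t \<in> carr (tensor_space (dual sH) (dual sH))"
        using t tensor_span_mono[OF subset_refl \<open>A \<subseteq> carr (dual sH)\<close>] by (auto simp: tensor_space_def)
      ultimately have "dual_comult sH f = t" by (intro dual_comult_eqI[OF lin_f])
      then show ?thesis using t by simp
    qed
    ultimately show "left_coideal_subalgebra (dual sH) (dual_mult \<Delta>H) \<epsilon>H (dual_comult sH) A"
      by (simp add: left_coideal_subalgebra_def is_subalgebra_def)
  qed
  then show ?thesis unfolding A_def .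
qed

end

section \<open>Algebras on triple tensor products\<close>

text \<open>
  Additivity of $v \otimes w$ in each factor holds as an equation of functionals, since the default value
  $0$ at forms that are not bilinear is additive as well.
\<close>

lemma bilinear_form_tensor:
  assumes cl: "closed_vspace V" "closed_vspace W" and \<phi>: "linear_form (tensor_space V W) \<phi>"
  shows "bilinear_form V W (\<lambda>v w. \<phi> (tensor V W v w))"
proof -
  have "tensor V W v (w + w') = tensor V W v w + tensor V W v w'"
    "tensor V W v (scl W c w) = fscale c (tensor V W v w)"
    if "v \<in> carr V" "w \<in> carr W" "w' \<in> carr W" for v w w' c
    using that by (auto simp: tensor_def fun_eq_iff fscale_def bilinear_form_def linear_form_def)
  moreover have "tensor V W (v + v') w = tensor V W v w + tensor V W v' w"
    "tensor V W (scl V c v) w = fscale c (tensor V W v w)"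
    if "v \<in> carr V" "v' \<in> carr V" "w \<in> carr W" for v v' w c
    using that by (auto simp: tensor_def fun_eq_iff fscale_def bilinear_form_def linear_form_def)
  ultimately show ?thesis
    using \<phi> by (simp add: bilinear_form_def linear_form_def tensor_mem)
qed

lemma ttensor_spaceI:
  assumes "\<And>i. i \<in> I \<Longrightarrow> x i \<in> carr U" "\<And>i. i \<in> I \<Longrightarrow> y i \<in> carr V" "\<And>i. i \<in> I \<Longrightarrow> z i \<in> carr W"
  shows "(\<lambda>\<tau>. \<Sum>i\<in>I. c i * ttensor U V W (x i) (y i) (z i) \<tau>) \<in> carr (ttensor_space U V W)"
proof -
  have "(\<lambda>\<tau>. \<Sum>i\<in>I. c i * ttensor U V W (x i) (y i) (z i) \<tau>) =
      (\<Sum>i\<in>I. fscale (c i) (ttensor U V W (x i) (y i) (z i)))"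
    by (simp add: fun_eq_iff sum_fun_apply fscale_def)
  also have "\<dots> \<in> carr (ttensor_space U V W)"
    unfolding ttensor_space_def vspace.simps using assms
    by (intro fscale.span_sum fscale.span_scale fscale.span_base) blast
  finally show ?thesis .
qed

lemma ttensor_space_sum:
  assumes "\<And>i. i \<in> I \<Longrightarrow> t i \<in> carr (ttensor_space U V W)"
  shows "(\<lambda>\<tau>. \<Sum>i\<in>I. t i \<tau>) \<in> carr (ttensor_space U V W)"
proof -
  have "(\<lambda>\<tau>. \<Sum>i\<in>I. t i \<tau>) = (\<Sum>i\<in>I. t i)" by (simp add: fun_eq_iff sum_fun_apply)
  also have "\<dots> \<in> carr (ttensor_space U V W)"
    using assms by (simp add: ttensor_space_def fscale.span_sum)
  finally show ?thesis .
qed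

lemma trilinear_form_zero: "trilinear_form U V W (\<lambda>u v w. 0)"
  by (simp add: trilinear_form_def)

text \<open>
  A pure tensor evaluates to $0$ at a form that is not trilinear. Therefore the form obtained by
  multiplying into $\tau$ has to be shown trilinear before the left factor $1 \otimes 1 \otimes 1$ can be
  evaluated; this is where bilinearity and closure of \<open>m\<close> enter.
\<close>

lemma ttensor_mult_one_left:
  assumes D: "closed_vspace D" and one: "one \<in> carr D"
    and closed: "\<And>a b. a \<in> carr D \<Longrightarrow> b \<in> carr D \<Longrightarrow> m a b \<in> carr D"
    and left: "\<And>a a' b. a \<in> carr D \<Longrightarrow> a' \<in> carr D \<Longrightarrow> b \<in> carr D \<Longrightarrow> m (a + a') b = m a b + m a' b"
      "\<And>c a b. a \<in> carr D \<Longrightarrow> b \<in> carr D \<Longrightarrow> m (scl D c a) b = scl D c (m a b)"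
    and right: "\<And>a b b'. a \<in> carr D \<Longrightarrow> b \<in> carr D \<Longrightarrow> b' \<in> carr D \<Longrightarrow> m a (b + b') = m a b + m a b'"
      "\<And>c a b. a \<in> carr D \<Longrightarrow> b \<in> carr D \<Longrightarrow> m a (scl D c b) = scl D c (m a b)"
    and unit: "\<And>a. a \<in> carr D \<Longrightarrow> m one a = a"
    and p: "p \<in> carr (ttensor_space D D D)"
  shows "ttensor_mult D m (ttensor D D D one one one) p = p"
proof
  fix \<tau>
  obtain n :: nat and c x y z
    where x: "\<And>i. i < n \<Longrightarrow> x i \<in> carr D" and y: "\<And>i. i < n \<Longrightarrow> y i \<in> carr D" and z: "\<And>i. i < n \<Longrightarrow> z i \<in> carr D"
    and exp: "\<And>\<tau>. trilinear_form D D D \<tau> \<Longrightarrow> p \<tau> = (\<Sum>i<n. c i * \<tau> (x i) (y i) (z i))"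
    and nontri: "\<And>\<tau>. \<not> trilinear_form D D D \<tau> \<Longrightarrow> p \<tau> = 0"
    by (rule ttensor_expansion[OF p]) (rule that)
  show "ttensor_mult D m (ttensor D D D one one one) p \<tau> = p \<tau>"
  proof (cases "trilinear_form D D D \<tau>")
    case True
    have L: "linear_form D (\<lambda>a. f (m a b))" if "linear_form D f" "b \<in> carr D" for f b
      using that closed left by (simp add: linear_form_def)
    have R: "linear_form D (\<lambda>b. f (m a b))" if "linear_form D f" "a \<in> carr D" for f a
      using that closed right by (simp add: linear_form_def)
    have \<tau>: "linear_form D (\<lambda>w. \<tau> u v w)" "linear_form D (\<lambda>w. \<tau> u w v)" "linear_form D (\<lambda>w. \<tau> w u v)"
      if "u \<in> carr D" "v \<in> carr D" for u v
      using True that by (simp_all add: trilinear_form_def)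
    have inner: "trilinear_form D D D (\<lambda>a' b' c'. \<tau> (m a a') (m b b') (m d c'))"
      if "a \<in> carr D" "b \<in> carr D" "d \<in> carr D" for a b d
      unfolding trilinear_form_def using that
      by (intro conjI ballI R[OF \<tau>(1)] R[OF \<tau>(2)] R[OF \<tau>(3)] closed)
    define F where "F a b d = p (\<lambda>a' b' c'. ttensor D D D (m a a') (m b b') (m d c') \<tau>)" for a b d
    have F: "F a b d = (\<Sum>i<n. c i * \<tau> (m a (x i)) (m b (y i)) (m d (z i)))"
      if "a \<in> carr D" "b \<in> carr D" "d \<in> carr D" for a b d
      using True by (simp add: F_def ttensor_def exp[OF inner[OF that]])
    have "trilinear_form D D D (\<lambda>a b d. \<Sum>i<n. c i * \<tau> (m a (x i)) (m b (y i)) (m d (z i)))"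
      unfolding trilinear_form_def
      by (intro conjI ballI linear_form_sum linear_form_scaled L[OF \<tau>(1)] L[OF \<tau>(2)] L[OF \<tau>(3)] closed)
        (simp_all add: x y z)
    then have "trilinear_form D D D F"
      using trilinear_form_cong[OF D D D, of F] F by auto
    then have "ttensor_mult D m (ttensor D D D one one one) p \<tau> = F one one one"
      by (simp add: ttensor_mult_def F_def[abs_def] ttensor_def[of _ _ _ one])
    also have "\<dots> = p \<tau>"
      using x y z by (simp add: F one unit exp[OF True])
    finally show ?thesis .
  next
    case False
    then have "(\<lambda>a b d. p (\<lambda>a' b' c'. ttensor D D D (m a a') (m b b') (m d c') \<tau>)) = (\<lambda>a b d. 0)"
      by (simp add: ttensor_def exp[OF trilinear_form_zero])
    then have "ttensor_mult D m (ttensor D D D one one one) p \<tau> = 0"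
      by (simp add: ttensor_mult_def) (simp add: ttensor_def)
    then show ?thesis by (simp add: nontri[OF False])
  qed
qed

section \<open>The smash product and its associator\<close>

context partially_admissible_mapping_system
begin

abbreviation D :: "('k, ('k, 'c \<Rightarrow> 'k, 'b) tensor2) vspace" where
  "D \<equiv> smash_space sB sC"

abbreviation smash_pure (infix \<open>#\<^sub>D\<close> 75) where "f #\<^sub>D b \<equiv> smash sB sC f b"

abbreviation smash_times where "smash_times \<equiv> smash_mult sH sB \<rho> sC \<Delta>C act"

lemmas closed_factors = closed_dual[OF vector_spaces(3)] closed_whole[of sB]

lemma closed_D: "closed_vspace D"
  by (simp add: smash_space_def)

lemma scl_D [simp]: "scl D = fscale"
  by (simp add: smash_space_def)

lemma smash_mem: "lin sC (*) f \<Longrightarrow> f #\<^sub>D b \<in> carr D"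
  by (simp add: smash_def smash_space_def tensor_mem)

lemma smash_form:
  assumes "linear_form D \<phi>"
  shows "lin sC (*) f \<Longrightarrow> lin sB (*) (\<lambda>b. \<phi> (f #\<^sub>D b))" "linear_form (dual sC) (\<lambda>f. \<phi> (f #\<^sub>D b))"
  using bilinear_form_tensor[OF closed_factors, of \<phi>] assms
  by (simp_all add: smash_def smash_space_def bilinear_form_def linear_form_whole vector_spaces)

lemma lin_dual_mult:
  assumes f: "lin sC (*) f" and g: "lin sC (*) g"
  shows "lin sC (*) (dual_mult \<Delta>C f g)"
  unfolding dual_mult_def by (intro lin_intros)

lemma linear_form_dual_mult:
  assumes \<phi>: "linear_form (dual sC) \<phi>" and f: "lin sC (*) f"
  shows "linear_form (dual sC) (\<lambda>g. \<phi> (dual_mult \<Delta>C f g))" "linear_form (dual sC) (\<lambda>g. \<phi> (dual_mult \<Delta>C g f))"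
proof -
  have bil: "bilinear_form (whole sC) (whole sC) (\<lambda>a b. g a * h b)" if "lin sC (*) g" "lin sC (*) h" for g h
    by (intro bilinear_form_wholeI lin_intros lin_compose[OF that(1)] lin_compose[OF that(2)])
  have "dual_mult \<Delta>C f (g + h) = dual_mult \<Delta>C f g + dual_mult \<Delta>C f h"
    "dual_mult \<Delta>C (g + h) f = dual_mult \<Delta>C g f + dual_mult \<Delta>C h f"
    if "lin sC (*) g" "lin sC (*) h" for g h
    using bil that f
    by (simp_all add: dual_mult_def fun_eq_iff distrib_left distrib_right tensor_add[OF C.comult_closed])
  moreover have "dual_mult \<Delta>C f (fscale c g) = fscale c (dual_mult \<Delta>C f g)"
    "dual_mult \<Delta>C (fscale c g) f = fscale c (dual_mult \<Delta>C g f)"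
    if "lin sC (*) g" for g c
    using tensor_scale[OF C.comult_closed bil[OF f that]] tensor_scale[OF C.comult_closed bil[OF that f]]
    by (simp_all add: dual_mult_def fun_eq_iff fscale_def mult.assoc mult.left_commute[of _ c])
  ultimately show "linear_form (dual sC) (\<lambda>g. \<phi> (dual_mult \<Delta>C f g))"
    "linear_form (dual sC) (\<lambda>g. \<phi> (dual_mult \<Delta>C g f))"
    using \<phi> f by (simp_all add: linear_form_def lin_dual_mult)
qed

lemma dual_mult_counit: "lin sC (*) g \<Longrightarrow> dual_mult \<Delta>C \<epsilon>C g = g"
  by (simp add: dual_mult_def C.counit_form)

text \<open>
  The product $(f \# b)(g \# c)$. The smash product of arbitrary elements is obtained by pairing this
  functional twice, which is meaningful only once it is known to be bilinear in $(f,b)$ and in $(g,c)$.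
\<close>

definition smash_pure_mult ::
  "('c \<Rightarrow> 'k) \<Rightarrow> 'b \<Rightarrow> ('c \<Rightarrow> 'k) \<Rightarrow> 'b \<Rightarrow> ('k, 'c \<Rightarrow> 'k, 'b) tensor2" where
  "smash_pure_mult f b g c = (\<lambda>\<beta>. dual_coaction sC sH act g (\<lambda>g1 g2. \<rho> b (\<lambda>b1 b2.
     (dual_mult \<Delta>C f g1 #\<^sub>D sB (g2 b1) (b2 * c)) \<beta>)))"

lemma smash_mult_pure: "smash_times u v = (\<lambda>\<beta>. u (\<lambda>f b. v (\<lambda>g c. smash_pure_mult f b g c \<beta>)))"
  by (simp add: smash_mult_def smash_pure_mult_def)

lemma smash_mult_left:
  "smash_times (u + u') v = smash_times u v + smash_times u' v" "smash_times (fscale c u) v = fscale c (smash_times u v)"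
  by (simp_all add: smash_mult_pure fun_eq_iff fscale_def)

lemma D_span: "carr D = fscale.span {f #\<^sub>D b | f b. lin sC (*) f}"
  by (simp add: smash_space_def tensor_space_def tensor_span_def smash_def)

lemma D_closed: "u \<in> carr D \<Longrightarrow> v \<in> carr D \<Longrightarrow> u + v \<in> carr D" "u \<in> carr D \<Longrightarrow> fscale c u \<in> carr D" "0 \<in> carr D"
  using closed_D by (simp_all add: closed_vspace_def)

lemma D_induct [consumes 1, case_names zero step]:
  assumes "v \<in> carr D" and "P 0"
    and "\<And>c f b v. lin sC (*) f \<Longrightarrow> v \<in> carr D \<Longrightarrow> P v \<Longrightarrow> P (fscale c (f #\<^sub>D b) + v)"
  shows "P v"
proof -
  have "v \<in> carr D \<and> P v"
    using assms(1)[unfolded D_span]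
  proof (induction rule: fscale.span_induct_alt)
    case base
    show ?case using D_closed(3) assms(2) by blast
  next
    case (step c x y)
    then obtain f b where x: "x = f #\<^sub>D b" "lin sC (*) f" by blast
    then show ?case
      using step assms(3)[OF x(2)] D_closed smash_mem[OF x(2)] by blast
  qed
  then show ?thesis ..
qed

lemmas act_bilinear = act_linear_left act_linear_right

context
  fixes E E'
  assumes E: "finite_dimensional_vector_space sC E" and E': "finite_dimensional_vector_space sH E'"
begin

abbreviation coordC where "coordC e x \<equiv> module.representation sC E x e"
abbreviation coordH where "coordH e' h \<equiv> module.representation sH E' h e'"

lemma lin_coord: "lin sC (*) (\<lambda>x. coordC e x)" "lin sH (*) (\<lambda>h. coordH e' h)"
  by (intro lin_coordinate[OF E] lin_coordinate[OF E'] lin_intros)+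

lemma smash_pure_mult_not_bilinear:
  assumes "lin sC (*) g" "\<not> bilinear_form (dual sC) (whole sB) \<beta>"
  shows "smash_pure_mult f b g c \<beta> = 0"
  using assms
  by (simp add: smash_pure_mult_def smash_def tensor_def tensor_zero[OF coaction_closed]
      tensor_zero[OF dual_coaction_mem[OF E E' act_bilinear]])

text \<open>
  Evaluating the coaction on \<open>g\<close> in dual bases replaces the functional \<open>dual_coaction\<close> by a finite
  sum, from which linearity in each of $f$, $b$, $g$, $c$ can be read off.
\<close>

lemma smash_pure_mult_form:
  assumes \<beta>: "bilinear_form (dual sC) (whole sB) \<beta>" and f: "lin sC (*) f" and g: "lin sC (*) g"
  shows "smash_pure_mult f b g c \<beta> = (\<Sum>e\<in>E. \<Sum>e'\<in>E'. g (act e e') *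
    \<rho> b (\<lambda>b1 b2. \<beta> (dual_mult \<Delta>C f (\<lambda>x. coordC e x)) (sB (coordH e' b1) (b2 * c))))"
proof -
  have \<beta>1: "linear_form (dual sC) (\<lambda>f. \<beta> f b)" for b using \<beta> by (simp add: bilinear_form_def)
  have \<beta>2: "lin sB (*) (\<beta> f)" if "lin sC (*) f" for f
    using \<beta> that by (simp add: bilinear_form_def linear_form_whole vector_spaces)
  have bil: "bilinear_form (whole sH) (whole sB) (\<lambda>b1 b2. \<beta> (dual_mult \<Delta>C f g1) (sB (g2 b1) (b2 * c)))"
    if "lin sC (*) g1" "lin sH (*) g2" for g1 g2
    by (intro bilinear_form_wholeI lin_intros lin_compose[OF \<beta>2] lin_dual_mult f that)
  have "bilinear_form (dual sC) (dual sH) (\<lambda>g1 g2. \<rho> b (\<lambda>b1 b2.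
      \<beta> (dual_mult \<Delta>C f g1) (sB (g2 b1) (b2 * c))))"
    unfolding bilinear_form_def
  proof (intro conjI ballI)
    fix g1 assume g1: "g1 \<in> carr (dual sC)"
    have lin: "lin sB (*) (\<beta> (dual_mult \<Delta>C f g1))" using g1 by (simp add: \<beta>2 lin_dual_mult f)
    show "linear_form (dual sH) (\<lambda>g2. \<rho> b (\<lambda>b1 b2. \<beta> (dual_mult \<Delta>C f g1) (sB (g2 b1) (b2 * c))))"
    proof (rule linear_form_tensor[OF coaction_closed])
      show "closed_vspace (dual sH)" by (simp add: vector_spaces)
      show "linear_form (dual sH) (\<lambda>g2. \<beta> (dual_mult \<Delta>C f g1) (sB (g2 v) (w * c)))" for v w
        by (simp add: linear_form_def fscale_def form_scale(2)[OF lin] distrib_right mult.assoc)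
    qed (use g1 bil in auto)
  next
    fix g2 assume g2: "g2 \<in> carr (dual sH)"
    show "linear_form (dual sC) (\<lambda>g1. \<rho> b (\<lambda>b1 b2. \<beta> (dual_mult \<Delta>C f g1) (sB (g2 b1) (b2 * c))))"
    proof (rule linear_form_tensor[OF coaction_closed])
      show "closed_vspace (dual sC)" by (simp add: vector_spaces)
      show "linear_form (dual sC) (\<lambda>g1. \<beta> (dual_mult \<Delta>C f g1) (sB (g2 v) (w * c)))" for v w
        by (rule linear_form_dual_mult(1)[OF \<beta>1 f])
    qed (use g2 bil in auto)
  qed
  from dual_coaction_form[OF E E' act_bilinear g this]
  show ?thesis by (simp add: smash_pure_mult_def smash_def tensor_def \<beta>)
qed

lemma smash_pure_mult_mem:
  assumes f: "lin sC (*) f" and g: "lin sC (*) g"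
  shows "smash_pure_mult f b g c \<in> carr D"
proof -
  obtain n :: nat and r u v
    where "\<And>i. i < n \<Longrightarrow> u i \<in> carr (whole sH)" "\<And>i. i < n \<Longrightarrow> v i \<in> carr (whole sB)"
      and exp: "\<And>\<beta>. bilinear_form (whole sH) (whole sB) \<beta> \<Longrightarrow> \<rho> b \<beta> = (\<Sum>i<n. r i * \<beta> (u i) (v i))"
      and "\<And>\<beta>. \<not> bilinear_form (whole sH) (whole sB) \<beta> \<Longrightarrow> \<rho> b \<beta> = 0"
    by (rule tensor_expansion[OF coaction_closed]) (rule that)
  define F where "F e = dual_mult \<Delta>C f (\<lambda>x. coordC e x)" for e
  have F: "lin sC (*) (F e)" for e by (simp add: F_def lin_dual_mult f lin_coord)
  have "smash_pure_mult f b g c \<beta> = (\<Sum>(e, e', i)\<in>E \<times> E' \<times> {..<n}.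
      (g (act e e') * r i) * (F e #\<^sub>D sB (coordH e' (u i)) (v i * c)) \<beta>)" for \<beta>
  proof (cases "bilinear_form (dual sC) (whole sB) \<beta>")
    case True
    have \<beta>: "lin sB (*) (\<beta> (F e))" for e
      using True F by (simp add: bilinear_form_def linear_form_whole vector_spaces)
    have "bilinear_form (whole sH) (whole sB) (\<lambda>b1 b2. \<beta> (F e) (sB (coordH e' b1) (b2 * c)))" for e e'
      by (intro bilinear_form_wholeI lin_intros lin_compose[OF \<beta>] lin_coordinate[OF E'])
    then show ?thesis
      by (simp add: smash_pure_mult_form[OF True f g] F_def[symmetric] exp smash_def tensor_def True
          sum.cartesian_product[symmetric] sum_distrib_left mult.assoc)
  next
    case False
    then show ?thesis by (simp add: smash_pure_mult_not_bilinear[OF g False] smash_def tensor_def)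
  qed
  then have "smash_pure_mult f b g c = (\<lambda>\<beta>. \<Sum>p\<in>E \<times> E' \<times> {..<n}.
      (g (act (fst p) (fst (snd p))) * r (snd (snd p))) *
        tensor (dual sC) (whole sB) (F (fst p)) (sB (coordH (fst (snd p)) (u (snd (snd p)))) (v (snd (snd p)) * c)) \<beta>)"
    by (simp add: fun_eq_iff case_prod_beta smash_def)
  also have "\<dots> \<in> carr D"
    unfolding smash_space_def tensor_space_def vspace.simps by (rule tensor_spanI) (simp_all add: F)
  finally show ?thesis .
qed

lemma smash_pure_mult_bilinear_right:
  assumes \<beta>: "bilinear_form (dual sC) (whole sB) \<beta>" and f: "lin sC (*) f"
  shows "bilinear_form (dual sC) (whole sB) (\<lambda>g c. smash_pure_mult f b g c \<beta>)"
proof -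
  have \<beta>2: "lin sB (*) (\<beta> (dual_mult \<Delta>C f (\<lambda>x. coordC e x)))" for e
    using \<beta> by (simp add: bilinear_form_def linear_form_whole vector_spaces lin_dual_mult f lin_coord)
  have "bilinear_form (dual sC) (whole sB) (\<lambda>g c. \<Sum>e\<in>E. \<Sum>e'\<in>E'. g (act e e') *
    \<rho> b (\<lambda>b1 b2. \<beta> (dual_mult \<Delta>C f (\<lambda>x. coordC e x)) (sB (coordH e' b1) (b2 * c))))"
    unfolding bilinear_form_def
  proof (intro conjI ballI linear_form_sum)
    fix g e e'
    show "linear_form (whole sB) (\<lambda>c. g (act e e') *
        \<rho> b (\<lambda>b1 b2. \<beta> (dual_mult \<Delta>C f (\<lambda>x. coordC e x)) (sB (coordH e' b1) (b2 * c))))"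
      unfolding linear_form_whole[OF vector_spaces(2)]
      by (intro lin_intros lin_compose[OF \<beta>2] lin_coordinate[OF E'])
  next
    fix c e e'
    show "linear_form (dual sC) (\<lambda>g. g (act e e') *
        \<rho> b (\<lambda>b1 b2. \<beta> (dual_mult \<Delta>C f (\<lambda>x. coordC e x)) (sB (coordH e' b1) (b2 * c))))"
      by (rule linear_form_scaled(2)) (simp add: linear_form_def fscale_def)
  qed
  then show ?thesis
    by (subst bilinear_form_cong[OF closed_factors]) (simp_all add: smash_pure_mult_form[OF \<beta> f])
qed

lemma smash_pure_mult_bilinear_left:
  assumes \<beta>: "bilinear_form (dual sC) (whole sB) \<beta>" and g: "lin sC (*) g"
  shows "bilinear_form (dual sC) (whole sB) (\<lambda>f b. smash_pure_mult f b g c \<beta>)"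
proof -
  have \<beta>1: "linear_form (dual sC) (\<lambda>f. \<beta> f b)" for b using \<beta> by (simp add: bilinear_form_def)
  have \<beta>2: "lin sB (*) (\<beta> f)" if "lin sC (*) f" for f
    using \<beta> that by (simp add: bilinear_form_def linear_form_whole vector_spaces)
  have "bilinear_form (dual sC) (whole sB) (\<lambda>f b. \<Sum>e\<in>E. \<Sum>e'\<in>E'. g (act e e') *
    \<rho> b (\<lambda>b1 b2. \<beta> (dual_mult \<Delta>C f (\<lambda>x. coordC e x)) (sB (coordH e' b1) (b2 * c))))"
    unfolding bilinear_form_def
  proof (intro conjI ballI linear_form_sum)
    fix f e e'
    show "linear_form (whole sB) (\<lambda>b. g (act e e') *
        \<rho> b (\<lambda>b1 b2. \<beta> (dual_mult \<Delta>C f (\<lambda>x. coordC e x)) (sB (coordH e' b1) (b2 * c))))"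
      unfolding linear_form_whole[OF vector_spaces(2)] by (intro lin_intros)
  next
    fix b e e'
    show "linear_form (dual sC) (\<lambda>f. g (act e e') *
        \<rho> b (\<lambda>b1 b2. \<beta> (dual_mult \<Delta>C f (\<lambda>x. coordC e x)) (sB (coordH e' b1) (b2 * c))))"
    proof (intro linear_form_scaled(1) linear_form_tensor[OF coaction_closed])
      show "closed_vspace (dual sC)" by (rule closed_factors)
      show "linear_form (dual sC) (\<lambda>f. \<beta> (dual_mult \<Delta>C f (\<lambda>x. coordC e x)) (sB (coordH e' v) (w * c)))" for v w
        by (rule linear_form_dual_mult(2)[OF \<beta>1 lin_coord(1)])
      fix f assume "f \<in> carr (dual sC)"
      then have f: "lin sB (*) (\<beta> (dual_mult \<Delta>C f (\<lambda>x. coordC e x)))" by (simp add: \<beta>2 lin_dual_mult lin_coord)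
      show "bilinear_form (whole sH) (whole sB) (\<lambda>b1 b2. \<beta> (dual_mult \<Delta>C f (\<lambda>x. coordC e x)) (sB (coordH e' b1) (b2 * c)))"
        by (intro bilinear_form_wholeI lin_intros lin_compose[OF f] lin_coordinate[OF E'])
    qed
  qed
  then show ?thesis
    by (subst bilinear_form_cong[OF closed_factors]) (simp_all add: smash_pure_mult_form[OF \<beta> _ g])
qed

lemma smash_pure_mult_bilinear_outer:
  assumes v: "v \<in> carr D" and \<beta>: "bilinear_form (dual sC) (whole sB) \<beta>"
  shows "bilinear_form (dual sC) (whole sB) (\<lambda>f b. v (\<lambda>g c. smash_pure_mult f b g c \<beta>))"
  unfolding bilinear_form_def
proof (intro conjI ballI)
  have *: "v \<in> carr (tensor_space (dual sC) (whole sB))" using v by (simp add: smash_space_def)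
  note left = smash_pure_mult_bilinear_left[OF \<beta>, unfolded bilinear_form_def]
  show "linear_form (whole sB) (\<lambda>b. v (\<lambda>g c. smash_pure_mult f b g c \<beta>))" if "f \<in> carr (dual sC)" for f
    using that left smash_pure_mult_bilinear_right[OF \<beta>]
    by (intro linear_form_tensor[OF * closed_factors(2)]) auto
  show "linear_form (dual sC) (\<lambda>f. v (\<lambda>g c. smash_pure_mult f b g c \<beta>))" for b
    using left smash_pure_mult_bilinear_right[OF \<beta>]
    by (intro linear_form_tensor[OF * closed_factors(1)]) auto
qed

lemma smash_mult_smash:
  assumes f: "lin sC (*) f" and g: "lin sC (*) g"
  shows "smash_times (f #\<^sub>D b) (g #\<^sub>D c) = smash_pure_mult f b g c"
proof
  fix \<beta>
  show "smash_times (f #\<^sub>D b) (g #\<^sub>D c) \<beta> = smash_pure_mult f b g c \<beta>"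
  proof (cases "bilinear_form (dual sC) (whole sB) \<beta>")
    case True
    have "smash_times (f #\<^sub>D b) (g #\<^sub>D c) \<beta> = (g #\<^sub>D c) (\<lambda>g c. smash_pure_mult f b g c \<beta>)"
      using smash_pure_mult_bilinear_outer[OF smash_mem[OF g] True]
      by (simp add: smash_mult_pure smash_def tensor_def)
    also have "\<dots> = smash_pure_mult f b g c \<beta>"
      using smash_pure_mult_bilinear_right[OF True f] by (simp add: smash_def tensor_def)
    finally show ?thesis .
  next
    case False
    have "(g #\<^sub>D c) (\<lambda>g c. smash_pure_mult f b g c \<beta>) = 0" for f b
      by (simp add: smash_def tensor_def smash_pure_mult_not_bilinear[OF g False])
    then show ?thesis
      by (simp add: smash_mult_pure smash_pure_mult_not_bilinear[OF g False]) (simp add: smash_def tensor_def)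
  qed
qed

lemma smash_pure_mult_zero:
  assumes "v \<in> carr D" "\<not> bilinear_form (dual sC) (whole sB) \<beta>"
  shows "v (\<lambda>g c. smash_pure_mult f b g c \<beta>) = 0"
proof -
  have v: "v \<in> carr (tensor_space (dual sC) (whole sB))" using assms(1) by (simp add: smash_space_def)
  have "v (\<lambda>g c. smash_pure_mult f b g c \<beta>) = v (\<lambda>g c. 0)"
    by (rule tensor_cong[OF v closed_factors]) (simp add: smash_pure_mult_not_bilinear assms(2))
  then show ?thesis by (simp add: tensor_zero[OF v])
qed

text \<open>
  Left linearity is immediate because the left factor is the outermost functional; on the right it
  depends on the left factor respecting sums of bilinear forms.
\<close>

lemma smash_mult_linear_right:
  assumes u: "u \<in> carr D"
  shows "linear_form D (\<lambda>v. smash_times u v \<beta>)"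
proof -
  have u': "u \<in> carr (tensor_space (dual sC) (whole sB))" using u by (simp add: smash_space_def)
  show ?thesis
  proof (cases "bilinear_form (dual sC) (whole sB) \<beta>")
    case True
    show ?thesis unfolding smash_mult_pure
    proof (rule linear_form_tensor[OF u' closed_D])
      show "linear_form D (\<lambda>v. v (\<lambda>g c. smash_pure_mult f b g c \<beta>))" for f b
        by (simp add: linear_form_def fscale_def)
    qed (rule smash_pure_mult_bilinear_outer[OF _ True])
  next
    case False
    have "smash_times u v \<beta> = 0" if "v \<in> carr D" for v
      by (simp add: smash_mult_pure smash_pure_mult_zero[OF that False] tensor_zero[OF u'])
    then show ?thesis using linear_form_cong[OF closed_D, of "\<lambda>v. smash_times u v \<beta>" "\<lambda>v. 0"] by simp
  qed
qed

lemma smash_mult_right: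
  assumes u: "u \<in> carr D" and v: "v \<in> carr D"
  shows "w \<in> carr D \<Longrightarrow> smash_times u (v + w) = smash_times u v + smash_times u w"
    "smash_times u (fscale c v) = fscale c (smash_times u v)"
proof -
  show "smash_times u (v + w) = smash_times u v + smash_times u w" if "w \<in> carr D"
    by (rule ext) (use smash_mult_linear_right[OF u] v that in \<open>simp add: linear_form_def\<close>)
  show "smash_times u (fscale c v) = fscale c (smash_times u v)"
  proof
    fix \<beta>
    have "smash_times u (scl D c v) \<beta> = c * smash_times u v \<beta>"
      using smash_mult_linear_right[OF u, of \<beta>] v unfolding linear_form_def by blast
    then show "smash_times u (fscale c v) \<beta> = fscale c (smash_times u v) \<beta>"
      by (simp add: fscale_def[of c "smash_times u v"])
  qed
qed

lemma smash_mult_mem: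
  assumes "u \<in> carr D" "v \<in> carr D"
  shows "smash_times u v \<in> carr D"
  using assms(1)
proof (induction rule: D_induct)
  case zero
  show ?case using D_closed(3) by (simp add: smash_mult_pure zero_fun_def)
next
  case (step c f b u)
  have "smash_times (f #\<^sub>D b) v \<in> carr D"
    using assms(2)
  proof (induction rule: D_induct)
    case zero
    have "smash_times (f #\<^sub>D b) 0 = 0"
      by (simp add: smash_mult_pure fun_eq_iff) (simp add: smash_def tensor_def)
    then show ?case by (simp only: D_closed(3))
  next
    case (step d g b' v)
    note f = \<open>lin sC (*) f\<close> and g = \<open>lin sC (*) g\<close>
    have "smash_times (f #\<^sub>D b) (fscale d (g #\<^sub>D b') + v) =
        fscale d (smash_pure_mult f b g b') + smash_times (f #\<^sub>D b) v"
      by (simp only: smash_mult_right(1)[OF smash_mem[OF f] D_closed(2)[OF smash_mem[OF g]] step(2)]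
          smash_mult_right(2)[OF smash_mem[OF f] smash_mem[OF g]] smash_mult_smash[OF f g])
    then show ?case
      using D_closed(1)[OF D_closed(2)[OF smash_pure_mult_mem[OF f g]] step(3)] by (simp only:)
  qed
  then show ?case
    using D_closed(1)[OF D_closed(2) step(3)] by (simp only: smash_mult_left)
qed

text \<open>
  For $f = \varepsilon$ and $b = 1$ the double sum over dual bases is
  $\sum_{e,e'} g(e \blacktriangleleft e')\, e'^*(1)\, e^* = \sum_e g(e \blacktriangleleft 1)\, e^* = g$.
\<close>

lemma smash_mult_one_left:
  assumes v: "v \<in> carr D"
  shows "smash_times (\<epsilon>C #\<^sub>D 1) v = v"
proof
  fix \<beta>
  have v': "v \<in> carr (tensor_space (dual sC) (whole sB))" using v by (simp add: smash_space_def)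
  show "smash_times (\<epsilon>C #\<^sub>D 1) v \<beta> = v \<beta>"
  proof (cases "bilinear_form (dual sC) (whole sB) \<beta>")
    case True
    have "smash_pure_mult \<epsilon>C 1 g c \<beta> = \<beta> g c" if g: "lin sC (*) g" for g c
    proof -
      have lin: "lin sB (*) (\<beta> f)" if "lin sC (*) f" for f
        using True that by (simp add: bilinear_form_def linear_form_whole vector_spaces)
      have "bilinear_form (whole sH) (whole sB) (\<lambda>b1 b2. \<beta> (\<lambda>x. coordC e x) (sB (coordH e' b1) (b2 * c)))" for e e'
        by (intro bilinear_form_wholeI lin_intros lin_compose[OF lin] lin_coordinate[OF E] lin_coordinate[OF E'])
      then have "smash_pure_mult \<epsilon>C 1 g c \<beta> =
          (\<Sum>e\<in>E. \<Sum>e'\<in>E'. g (act e e') * (coordH e' 1 * \<beta> (\<lambda>x. coordC e x) c))"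
        by (simp add: smash_pure_mult_form[OF True C.counit_linear g] dual_mult_counit lin_coord
            coaction_one tensor_def form_scale(2)[OF lin])
      also have "\<dots> = (\<Sum>e\<in>E. (\<Sum>e'\<in>E'. coordH e' 1 * g (act e e')) * \<beta> (\<lambda>x. coordC e x) c)"
        by (simp add: sum_distrib_left sum_distrib_right ac_simps)
      also have "\<dots> = (\<Sum>e\<in>E. g (act e 1) * \<beta> (\<lambda>x. coordC e x) c)"
      proof (intro sum.cong refl arg_cong2[where f = "(*)"])
        fix e
        show "(\<Sum>e'\<in>E'. coordH e' 1 * g (act e e')) = g (act e 1)"
          by (rule form_coordinates[OF E', symmetric]) (intro lin_intros lin_compose[OF g])
      qed
      also have "\<dots> = \<beta> g c"
        using True by (simp only: act_one) (rule linear_form_dual_basis[OF E _ g, symmetric], simp add: bilinear_form_def)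
      finally show ?thesis .
    qed
    then have "v (\<lambda>g c. smash_pure_mult \<epsilon>C 1 g c \<beta>) = v \<beta>"
      by (intro tensor_cong[OF v' closed_factors]) simp
    then show ?thesis
      using smash_pure_mult_bilinear_outer[OF v True] by (simp add: smash_mult_pure smash_def tensor_def)
  next
    case False
    have "smash_times (\<epsilon>C #\<^sub>D 1) v \<beta> = 0"
      by (simp add: smash_mult_pure smash_pure_mult_zero[OF v False]) (simp add: smash_def tensor_def)
    then show ?thesis by (simp add: tensor_not_bilinear[OF v' False])
  qed
qed

end

end

section \<open>Triviality of the associator\<close>

context partially_admissible_mapping_system
begin

abbreviation one_D where "one_D \<equiv> \<epsilon>C #\<^sub>D 1"

lemma smash_evaluation:
  assumes "lin sB (*) \<phi>"
  shows "(f #\<^sub>D b) (\<lambda>f b. f x * \<phi> b) = f x * \<phi> b"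
proof -
  have "bilinear_form (dual sC) (whole sB) (\<lambda>f b. f x * \<phi> b)"
    using assms
    by (simp add: bilinear_form_def linear_form_whole vector_spaces lin_scalar_mult)
      (simp add: linear_form_def fscale_def algebra_simps)
  then show ?thesis by (simp add: smash_def tensor_def)
qed

definition inv_assoc where
  "inv_assoc = inverse_associator \<Delta>H sB sC \<epsilon>C \<zeta> \<gamma>"

text \<open>
  The basis chosen inside \<open>inverse_associator\<close>.
\<close>

definition basisC where "basisC = (SOME E. finite_dimensional_vector_space sC E)"

lemma basisC: "finite_dimensional_vector_space sC basisC"
  unfolding basisC_def using finite_dimensional_C by (rule someI_ex)

abbreviation coord where "coord e x \<equiv> module.representation sC basisC x e"

lemma lin_coord_basisC: "lin r sC f \<Longrightarrow> lin r (*) (\<lambda>x. coord e (f x))"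
  by (rule lin_coordinate[OF basisC])

lemma inv_assoc_eq:
  "inv_assoc \<tau> = (\<Sum>i\<in>basisC. \<Sum>j\<in>basisC. \<Delta>H (\<gamma> j) (\<lambda>y1 y2.
     ttensor D D D (\<epsilon>C #\<^sub>D \<zeta> (\<gamma> i * y1)) ((\<lambda>x. coord i x) #\<^sub>D \<zeta> y2) ((\<lambda>x. coord j x) #\<^sub>D 1) \<tau>))"
  by (simp add: inv_assoc_def inverse_associator_def basisC_def[symmetric] Let_def)

lemma trilinear_smash:
  assumes \<tau>: "trilinear_form D D D \<tau>" and f: "lin sC (*) f" and g: "lin sC (*) g" and h: "lin sC (*) h"
  shows "lin sB (*) (\<lambda>b. \<tau> (f #\<^sub>D b) (g #\<^sub>D c) (h #\<^sub>D d))"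
    "lin sB (*) (\<lambda>c. \<tau> (f #\<^sub>D b) (g #\<^sub>D c) (h #\<^sub>D d))"
    "linear_form (dual sC) (\<lambda>g. \<tau> (f #\<^sub>D b) (g #\<^sub>D c) (h #\<^sub>D d))"
    "linear_form (dual sC) (\<lambda>h. \<tau> (f #\<^sub>D b) (g #\<^sub>D c) (h #\<^sub>D d))"
proof -
  have \<tau>1: "linear_form D (\<lambda>u. \<tau> u (g #\<^sub>D c) (h #\<^sub>D d))" and \<tau>2: "linear_form D (\<lambda>v. \<tau> (f #\<^sub>D b) v (h #\<^sub>D d))"
    and \<tau>3: "linear_form D (\<lambda>w. \<tau> (f #\<^sub>D b) (g #\<^sub>D c) w)" for b c d
    using \<tau> f g h by (simp_all add: trilinear_form_def smash_mem)
  show "lin sB (*) (\<lambda>b. \<tau> (f #\<^sub>D b) (g #\<^sub>D c) (h #\<^sub>D d))" by (rule smash_form(1)[OF \<tau>1 f])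
  show "lin sB (*) (\<lambda>c. \<tau> (f #\<^sub>D b) (g #\<^sub>D c) (h #\<^sub>D d))" by (rule smash_form(1)[OF \<tau>2 g])
  show "linear_form (dual sC) (\<lambda>g. \<tau> (f #\<^sub>D b) (g #\<^sub>D c) (h #\<^sub>D d))" by (rule smash_form(2)[OF \<tau>2])
  show "linear_form (dual sC) (\<lambda>h. \<tau> (f #\<^sub>D b) (g #\<^sub>D c) (h #\<^sub>D d))" by (rule smash_form(2)[OF \<tau>3])
qed

text \<open>
  Each Sweedler sum over $\Delta(\gamma(f_j^*))$ is a finite sum of pure tensors. The expansion is
  uniform in the trilinear form, so it is an identity of functionals.
\<close>

lemma inv_assoc_mem: "inv_assoc \<in> carr (ttensor_space D D D)"
proof -
  have coord: "lin sC (*) (\<lambda>x. coord e x)" for e by (intro lin_coord_basisC lin_intros)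
  have "(\<lambda>\<tau>. \<Delta>H (\<gamma> j) (\<lambda>y1 y2. ttensor D D D (\<epsilon>C #\<^sub>D \<zeta> (\<gamma> i * y1)) ((\<lambda>x. coord i x) #\<^sub>D \<zeta> y2)
      ((\<lambda>x. coord j x) #\<^sub>D 1) \<tau>)) \<in> carr (ttensor_space D D D)" (is "?t \<in> _") for i j
  proof -
    obtain n :: nat and r u v
      where "\<And>i. i < n \<Longrightarrow> u i \<in> carr (whole sH)" "\<And>i. i < n \<Longrightarrow> v i \<in> carr (whole sH)"
        and exp: "\<And>\<beta>. bilinear_form (whole sH) (whole sH) \<beta> \<Longrightarrow> \<Delta>H (\<gamma> j) \<beta> = (\<Sum>i<n. r i * \<beta> (u i) (v i))"
        and "\<And>\<beta>. \<not> bilinear_form (whole sH) (whole sH) \<beta> \<Longrightarrow> \<Delta>H (\<gamma> j) \<beta> = 0"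
      by (rule tensor_expansion[OF comult_closed]) (rule that)
    have "?t \<tau> = (\<Sum>k<n. r k * ttensor D D D (\<epsilon>C #\<^sub>D \<zeta> (\<gamma> i * u k)) ((\<lambda>x. coord i x) #\<^sub>D \<zeta> (v k))
        ((\<lambda>x. coord j x) #\<^sub>D 1) \<tau>)" for \<tau>
    proof (cases "trilinear_form D D D \<tau>")
      case True
      note \<tau> = trilinear_smash[OF True C.counit_linear coord coord]
      have "bilinear_form (whole sH) (whole sH) (\<lambda>y1 y2. \<tau> (\<epsilon>C #\<^sub>D \<zeta> (\<gamma> i * y1))
          ((\<lambda>x. coord i x) #\<^sub>D \<zeta> y2) ((\<lambda>x. coord j x) #\<^sub>D 1))"
        by (intro bilinear_form_wholeI lin_intros lin_compose[OF \<tau>(1)] lin_compose[OF \<tau>(2)])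
      then show ?thesis using True by (simp add: ttensor_def exp)
    next
      case False
      then show ?thesis by (simp add: ttensor_def tensor_zero[OF comult_closed])
    qed
    then have "?t = (\<lambda>\<tau>. \<Sum>k<n. r k * ttensor D D D (\<epsilon>C #\<^sub>D \<zeta> (\<gamma> i * u k)) ((\<lambda>x. coord i x) #\<^sub>D \<zeta> (v k))
        ((\<lambda>x. coord j x) #\<^sub>D 1) \<tau>)" by (rule ext)
    also have "\<dots> \<in> carr (ttensor_space D D D)"
      by (intro ttensor_spaceI smash_mem C.counit_linear coord)
    finally show ?thesis .
  qed
  then have "(\<lambda>\<tau>. \<Sum>i\<in>basisC. \<Sum>j\<in>basisC. \<Delta>H (\<gamma> j) (\<lambda>y1 y2.
     ttensor D D D (\<epsilon>C #\<^sub>D \<zeta> (\<gamma> i * y1)) ((\<lambda>x. coord i x) #\<^sub>D \<zeta> y2) ((\<lambda>x. coord j x) #\<^sub>D 1) \<tau>))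
       \<in> carr (ttensor_space D D D)"
    by (intro ttensor_space_sum)
  then show ?thesis by (simp add: inv_assoc_eq[symmetric])
qed

text \<open>
  Triviality of the inverse associator is tested on forms that evaluate the $C^*$-factors at points.
  The dual basis functions evaluated at \<open>x\<close> and \<open>y\<close> then collapse the double sum to the single
  coefficient $\sum \zeta(\gamma(x)\gamma(y)_{(1)}) \otimes \zeta(\gamma(y)_{(2)})$. Conversely, once all
  coefficients are $\varepsilon(f_i^*)\varepsilon(f_j^*)\,1 \otimes 1$, summing over the bases recovers
  $\varepsilon = \sum_i \varepsilon(f_i^*) f_i$ in both $C^*$-factors.
\<close>

lemma inv_assoc_trivial_iff:
  "inv_assoc = ttensor D D D one_D one_D one_D \<longleftrightarrow> comult_split \<and> mult_split"
proof
  assume trivial: "inv_assoc = ttensor D D D one_D one_D one_D"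
  show "comult_split \<and> mult_split"
  proof (rule split_if_associator_form)
    fix \<phi> \<psi> x y assume \<phi>: "lin sB (*) \<phi>" and \<psi>: "lin sB (*) \<psi>"
    note intros = lin_intros lin_compose[OF \<phi>] lin_compose[OF \<psi>]
    \<comment> \<open>In the first factor $\varepsilon$ is evaluated at $\pi(1)$ and in the third $\varepsilon\iota$ at $1$,
      so both contribute the factor $1$.\<close>
    define \<tau> :: "('k, 'c \<Rightarrow> 'k, 'b) tensor2 \<Rightarrow> ('k, 'c \<Rightarrow> 'k, 'b) tensor2 \<Rightarrow> ('k, 'c \<Rightarrow> 'k, 'b) tensor2 \<Rightarrow> 'k"
      where "\<tau> = (\<lambda>u v w. u (\<lambda>f b. f (\<pi> 1) * \<phi> b) * (v (\<lambda>f b. f x * \<psi> b) * w (\<lambda>f b. f y * \<epsilon>H (\<iota> b))))"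
    have \<epsilon>: "lin sB (*) (\<lambda>b. \<epsilon>H (\<iota> b))" by (intro lin_intros)
    have \<tau>: "trilinear_form D D D \<tau>"
      by (simp add: \<tau>_def trilinear_form_def linear_form_def fscale_def algebra_simps)
    have \<tau>_smash: "\<tau> (f #\<^sub>D a) (g #\<^sub>D b) (h #\<^sub>D c) = f (\<pi> 1) * \<phi> a * (g x * \<psi> b * (h y * \<epsilon>H (\<iota> c)))" for f g h a b c
      by (simp add: \<tau>_def smash_evaluation \<phi> \<psi> \<epsilon>)
    have "inv_assoc \<tau> = (\<Sum>i\<in>basisC. \<Sum>j\<in>basisC. \<Delta>H (\<gamma> j) (\<lambda>a b.
        coord i x * coord j y * (\<phi> (\<zeta> (\<gamma> i * a)) * \<psi> (\<zeta> b))))"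
      by (simp add: inv_assoc_eq ttensor_def \<tau> \<tau>_smash counit_pi_one iota_one counit_one ac_simps)
    also have "\<dots> = (\<Sum>i\<in>basisC. \<Sum>j\<in>basisC. coord i x * coord j y *
        \<Delta>H (\<gamma> j) (\<lambda>a b. \<phi> (\<zeta> (\<gamma> i * a)) * \<psi> (\<zeta> b)))"
      by (intro sum.cong refl comult_scale intros)
    also have "\<dots> = (\<Sum>i\<in>basisC. coord i x * (\<Sum>j\<in>basisC. coord j y *
        \<Delta>H (\<gamma> j) (\<lambda>a b. \<phi> (\<zeta> (\<gamma> i * a)) * \<psi> (\<zeta> b))))"
      by (simp add: sum_distrib_left mult.assoc)
    also have "\<dots> = (\<Sum>i\<in>basisC. coord i x * \<Delta>H (\<gamma> y) (\<lambda>a b. \<phi> (\<zeta> (\<gamma> i * a)) * \<psi> (\<zeta> b)))"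
    proof (intro sum.cong refl arg_cong2[where f = "(*)"])
      fix i
      show "(\<Sum>j\<in>basisC. coord j y * \<Delta>H (\<gamma> j) (\<lambda>a b. \<phi> (\<zeta> (\<gamma> i * a)) * \<psi> (\<zeta> b))) =
          \<Delta>H (\<gamma> y) (\<lambda>a b. \<phi> (\<zeta> (\<gamma> i * a)) * \<psi> (\<zeta> b))"
        by (rule form_coordinates[OF basisC, symmetric]) (intro intros)
    qed
    also have "\<dots> = \<Delta>H (\<gamma> y) (\<lambda>a b. \<phi> (\<zeta> (\<gamma> x * a)) * \<psi> (\<zeta> b))"
      by (rule form_coordinates[OF basisC, symmetric]) (intro intros)
    finally have "inv_assoc \<tau> = \<Delta>H (\<gamma> y) (\<lambda>a b. \<phi> (\<zeta> (\<gamma> x * a)) * \<psi> (\<zeta> b))" .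
    then show "\<Delta>H (\<gamma> y) (\<lambda>a b. \<phi> (\<zeta> (\<gamma> x * a)) * \<psi> (\<zeta> b)) = \<epsilon>C x * \<epsilon>C y * (\<phi> 1 * \<psi> 1)"
      using trivial by (simp add: ttensor_def \<tau> \<tau>_smash counit_pi_one iota_one counit_one ac_simps)
  qed
next
  assume "comult_split \<and> mult_split"
  then have P: comult_split and M: mult_split by auto
  have coord: "lin sC (*) (\<lambda>x. coord e x)" for e by (intro lin_coord_basisC lin_intros)
  show "inv_assoc = ttensor D D D one_D one_D one_D"
  proof
    fix \<tau>
    show "inv_assoc \<tau> = ttensor D D D one_D one_D one_D \<tau>"
    proof (cases "trilinear_form D D D \<tau>")
      case True
      note \<tau> = trilinear_smash[OF True C.counit_linear coord coord]
      note \<tau>1 = trilinear_smash[OF True C.counit_linear C.counit_linear coord]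
      note \<tau>2 = trilinear_smash[OF True C.counit_linear C.counit_linear C.counit_linear]
      have "inv_assoc \<tau> = (\<Sum>i\<in>basisC. \<Sum>j\<in>basisC. \<epsilon>C i * \<epsilon>C j *
          \<tau> one_D ((\<lambda>x. coord i x) #\<^sub>D 1) ((\<lambda>x. coord j x) #\<^sub>D 1))"
        unfolding inv_assoc_eq ttensor_def if_P[OF True]
        by (intro sum.cong refl associator_form[OF P M] \<tau>)
      also have "\<dots> = (\<Sum>j\<in>basisC. \<epsilon>C j * (\<Sum>i\<in>basisC. \<epsilon>C i *
          \<tau> one_D ((\<lambda>x. coord i x) #\<^sub>D 1) ((\<lambda>x. coord j x) #\<^sub>D 1)))"
        by (subst sum.swap) (simp add: sum_distrib_left ac_simps)
      also have "\<dots> = (\<Sum>j\<in>basisC. \<epsilon>C j * \<tau> one_D one_D ((\<lambda>x. coord j x) #\<^sub>D 1))"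
        using linear_form_dual_basis[OF basisC \<tau>1(3) C.counit_linear] by simp
      also have "\<dots> = \<tau> one_D one_D one_D"
        using linear_form_dual_basis[OF basisC \<tau>2(4) C.counit_linear] by simp
      finally show ?thesis by (simp add: ttensor_def True)
    next
      case False
      then show ?thesis by (simp add: inv_assoc_eq ttensor_def tensor_zero[OF comult_closed])
    qed
  qed
qed

text \<open>
  Multiplication by the unit tensor on the left is the identity, so the unit is a two-sided inverse of
  \<open>inv_assoc\<close> exactly when the two are equal.
\<close>

lemma admissible_iff: "admissible sH \<Delta>H sB \<rho> sC \<Delta>C \<epsilon>C act \<zeta> \<gamma> \<longleftrightarrow> comult_split \<and> mult_split"
proof -
  define unit where "unit = ttensor D D D one_D one_D one_D"
  obtain E' where E': "finite_dimensional_vector_space sH E'" using finite_dimensional by blast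
  note unit_left = smash_mult_one_left[OF basisC E']
  have one: "one_D \<in> carr D" by (rule smash_mem[OF C.counit_linear])
  have unit_mult: "ttensor_mult D smash_times unit p = p" if "p \<in> carr (ttensor_space D D D)" for p
    unfolding unit_def
    by (rule ttensor_mult_one_left[OF closed_D one _ _ _ _ _ _ that])
      (simp_all add: smash_mult_mem[OF basisC E'] smash_mult_left smash_mult_right[OF basisC E'] unit_left)
  have "(\<lambda>\<tau>. \<Sum>i\<in>{0::nat}. 1 * ttensor D D D one_D one_D one_D \<tau>) \<in> carr (ttensor_space D D D)"
    by (rule ttensor_spaceI) (simp_all add: one)
  then have mem: "unit \<in> carr (ttensor_space D D D)" by (simp add: unit_def)
  have "admissible sH \<Delta>H sB \<rho> sC \<Delta>C \<epsilon>C act \<zeta> \<gamma> \<longleftrightarrow> unit \<in> carr (ttensor_space D D D) \<and>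
      ttensor_mult D smash_times unit inv_assoc = unit \<and> ttensor_mult D smash_times inv_assoc unit = unit"
    by (simp add: admissible_def is_associator_def Let_def unit_def inv_assoc_def)
  also have "\<dots> \<longleftrightarrow> inv_assoc = unit"
    using unit_mult[OF inv_assoc_mem] unit_mult[OF mem] mem by auto
  also have "\<dots> \<longleftrightarrow> comult_split \<and> mult_split"
    unfolding unit_def by (rule inv_assoc_trivial_iff)
  finally show ?thesis .
qed

end

section \<open>The equivalence\<close>

theorem proposition6p5:
  fixes sH :: "'k::field \<Rightarrow> 'h::ring_1 \<Rightarrow> 'h"
    and \<Delta>H :: "'h \<Rightarrow> ('k, 'h, 'h) tensor2" and \<epsilon>H :: "'h \<Rightarrow> 'k" and S :: "'h \<Rightarrow> 'h"
    and sB :: "'k \<Rightarrow> 'b::ring_1 \<Rightarrow> 'b"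
    and \<rho> :: "'b \<Rightarrow> ('k, 'h, 'b) tensor2"
    and sC :: "'k \<Rightarrow> 'c::ab_group_add \<Rightarrow> 'c"
    and \<Delta>C :: "'c \<Rightarrow> ('k, 'c, 'c) tensor2" and \<epsilon>C :: "'c \<Rightarrow> 'k"
    and act :: "'c \<Rightarrow> 'h \<Rightarrow> 'c"
    and \<iota> :: "'b \<Rightarrow> 'h" and \<pi> :: "'h \<Rightarrow> 'c" and \<zeta> :: "'h \<Rightarrow> 'b" and \<gamma> :: "'c \<Rightarrow> 'h"
  assumes "partially_admissible_mapping_system sH \<Delta>H \<epsilon>H S sB \<rho> sC \<Delta>C \<epsilon>C act \<iota> \<pi> \<zeta> \<gamma>"
  shows "(admissible sH \<Delta>H sB \<rho> sC \<Delta>C \<epsilon>C act \<zeta> \<gamma> \<longleftrightarrow>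
            right_coideal_subalgebra (whole sH) (*) 1 \<Delta>H (range \<gamma>)) \<and>
         (right_coideal_subalgebra (whole sH) (*) 1 \<Delta>H (range \<gamma>) \<longleftrightarrow>
            left_coideal_subalgebra (dual sH) (dual_mult \<Delta>H) \<epsilon>H (dual_comult sH)
              (transpose_map \<zeta> ` carr (dual sB)))"
proof -
  interpret partially_admissible_mapping_system sH \<Delta>H \<epsilon>H S sB \<rho> sC \<Delta>C \<epsilon>C act \<iota> \<pi> \<zeta> \<gamma> by fact
  show ?thesis
    unfolding admissible_iff right_coideal_subalgebra_iff left_coideal_subalgebra_iff by simp
qed

end
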